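(* Assume that $N>3$ and $p\in(2,\infty]$. Then there exists a family $\bar{\mathcal{F}}_{I_N}=\{\bar f_i,\ i\in I_N\}$ of functions on $\mathcal{D}_0$, satisfying $\max_{i\in I_N}\|\bar f_i\|_p\le L$, such that for any selection rule $\tilde f:\mathcal{Y}_\varepsilon\to\bar{\mathcal{F}}_{I_N}$ and any $\varepsilon\le L(N\ln N)^{-1/2}$ one has $$\max_{f\in\bar{\mathcal{F}}_{I_N}}\Big[\mathcal{R}_p[\tilde f;f]-\min_{i\in I_N}\|f-\bar f_i\|_p\Big]\ge c\,K_p\,\varepsilon\sqrt{\ln(N-1)},$$ where $K_p=Q_1(\bar{\mathcal{F}}_{I_N},p)=Q_3(\bar{\mathcal{F}}_{I_N},p)$ for all $p\in[2,\infty)$, $K_\infty=Q_3(\bar{\mathcal{F}}_{I_N},\infty)=Q_4(\bar{\mathcal{F}}_{I_N},\gamma)$ for all $\gamma>0$, and $c$ is an absolute constant.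
   Context: Model: $\mathcal{D}_0=[0,1]^d$, $\varepsilon\in(0,1)$, and one observes $\mathcal{Y}_\varepsilon=\{Y_\varepsilon(t),t\in\mathcal{D}_0\}$ in the Gaussian white noise model $Y_\varepsilon(dt)=f(t)\,dt+\varepsilon W(dt)$, $t\in\mathcal{D}_0$, where $f:\mathbb{R}^d\to\mathbb{R}$ is an unknown function and $W$ is the standard Wiener process in $\mathbb{R}^d$. $\|\cdot\|_p$ is the $\mathbb{L}_p$-norm on $\mathcal{D}_0$, and $\mathcal{R}_p[\tilde f;f]:=\mathbb{E}_f\|\tilde f-f\|_p$, where $\mathbb{E}_f$ is the expectation with respect to the distribution of the observation $\mathcal{Y}_\varepsilon$ when the signal is $f$. $I_N=(1,\dots,N)$, and $L>0$ is a constant. Setting: model selection aggregation, where the members of a family are distinct fixed functions and a selection rule is a measurable choice, based on the observation $\mathcal{Y}_\varepsilon$, of one member of the family. For a family $\mathcal{F}_{I_N}=\{f_i,\ i\in I_N\}$ and a signal $f$, let $i_*=\arg\min_{i\in I_N}\|f-f_i\|_p$, and define $$Q_1(\mathcal{F}_{I_N},p)=\max_{i\in I_N,\,i\ne i_*}\Big[\frac{\|f_{i_*}-f_i\|_{2p-2}}{\|f_{i_*}-f_i\|_p}\Big]^{p-1}\ \text{ for } 2<p<\infty,\qquad Q_1(\mathcal{F}_{I_N},p)=1\ \text{ for } 1\le p\le 2,$$ $$Q_3(\mathcal{F}_{I_N},p)=\max_{i\in I_N,\,i\ne i_*}\frac{\|f_{i_*}-f_i\|_p}{\|f_{i_*}-f_i\|_2},$$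 $$Q_4(\mathcal{F}_{I_N},\gamma)=\max_{i\in I_N,\,i\neq i_*}\frac{\|S_{i_*i}(\cdot,\gamma)\|_2}{\|S_{i_*i}(\cdot,\gamma)\|_1},\qquad S_{i_*i}(\cdot,\gamma)=\big[|f_{i_*}(\cdot)-f_i(\cdot)|-\|f_{i_*}-f_i\|_\infty+\gamma\big]_+,$$ where $[\cdot]_+=\max\{\cdot,0\}$ (in $Q_4$, $i_*$ is taken with $p=\infty$).
   Formalization: The family may depend on ε (one family for all small ε is impossible), and K_∞ = Q_4(γ) is claimed only for 0 < γ ≤ min over i ≠ i_* of ‖f_{i_*} − f_i‖_∞, since Q_4(γ) tends to 1 as γ grows and the claim for all γ > 0 is false. *)

theory Defs
  imports "HOL-Probability.Probability"
begin

text \<open>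
  The dimension is an ordinary natural number, so that constants can be required not to depend
  on it: a point of the d-dimensional unit cube is an extensional function on \<open>{..<d}\<close>, and a
  signal is a real function of such points.
\<close>

type_synonym point = "nat \<Rightarrow> real"
type_synonym signal = "point \<Rightarrow> real"
type_synonym path = "point \<Rightarrow> real"

definition unit_cube :: "nat \<Rightarrow> point set" where
  "unit_cube d = {..<d} \<rightarrow>\<^sub>E {0..1}"

definition cube_measure :: "nat \<Rightarrow> point measure" where
  "cube_measure d = Pi\<^sub>M {..<d} (\<lambda>_. restrict_space lborel {0..1})"


section \<open>Norms\<close>

text \<open>The exponent ranges over \<open>1 \<le> p \<le> \<infinity>\<close>. The values are meaningful for functions in the
  corresponding space; membership in \<open>Linf_space\<close> gives this for every p, since the cube has
  measure 1.\<close>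

definition Lp_norm :: "nat \<Rightarrow> ereal \<Rightarrow> signal \<Rightarrow> real" where
  "Lp_norm d p g =
     (if p = \<infinity> then real_of_ereal (esssup (cube_measure d) (\<lambda>u. ereal \<bar>g u\<bar>))
      else (LINT u|cube_measure d. \<bar>g u\<bar> powr real_of_ereal p) powr (1 / real_of_ereal p))"

definition Linf_space :: "nat \<Rightarrow> signal set" where
  "Linf_space d = {g \<in> borel_measurable (cube_measure d).
     esssup (cube_measure d) (\<lambda>u. ereal \<bar>g u\<bar>) < \<infinity>}"

definition Lp_dist :: "nat \<Rightarrow> ereal \<Rightarrow> signal \<Rightarrow> signal \<Rightarrow> real" where
  "Lp_dist d p g h = Lp_norm d p (\<lambda>u. g u - h u)"


section \<open>The Gaussian white noise model\<close>

definition normal_law :: "real \<Rightarrow> real \<Rightarrow> real measure" where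
  "normal_law m v =
     (if v = 0 then return borel m else density lborel (\<lambda>x. ennreal (normal_density m (sqrt v) x)))"

definition path_space :: "nat \<Rightarrow> path measure" where
  "path_space d = Pi\<^sub>M (unit_cube d) (\<lambda>_. borel)"

text \<open>
  \<open>wiener_law d M\<close>: M is the distribution, on the product sigma-algebra, of the standard Wiener
  process indexed by the unit cube (for \<open>d > 1\<close> the Brownian sheet), i.e. of the centred Gaussian
  process with covariance \<open>(s, t) \<mapsto> (\<Prod>i<d. min (s i) (t i))\<close>. A process is Gaussian if each finite
  linear combination of its values is normal, possibly degenerate. The law on the product
  sigma-algebra is determined by these requirements. Path continuity is not an event of
  that sigma-algebra, hence does not appear; the law is that of the continuous version.
\<close>

definition wiener_cov :: "nat \<Rightarrow> point \<Rightarrow> point \<Rightarrow> real" where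
  "wiener_cov d s t = (\<Prod>i<d. min (s i) (t i))"

definition wiener_law :: "nat \<Rightarrow> path measure \<Rightarrow> bool" where
  "wiener_law d M \<longleftrightarrow>
     prob_space M \<and> sets M = sets (path_space d) \<and>
     (\<forall>J a. finite J \<and> J \<subseteq> unit_cube d \<longrightarrow>
        distr M borel (\<lambda>w. \<Sum>t\<in>J. a t * w t) =
        normal_law 0 (\<Sum>s\<in>J. \<Sum>t\<in>J. a s * a t * wiener_cov d s t))"

text \<open>\<open>Y(dt) = f(t) dt + \<epsilon> W(dt)\<close>, integrated over the boxes \<open>[0, t]\<close>.\<close>

definition drift :: "nat \<Rightarrow> signal \<Rightarrow> point \<Rightarrow> real" where
  "drift d f t = (LINT u:{u \<in> unit_cube d. \<forall>i<d. u i \<le> t i}|cube_measure d. f u)"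

definition observation :: "nat \<Rightarrow> real \<Rightarrow> signal \<Rightarrow> path \<Rightarrow> path" where
  "observation d \<epsilon> f w = (\<lambda>t\<in>unit_cube d. drift d f t + \<epsilon> * w t)"

definition observation_law :: "nat \<Rightarrow> real \<Rightarrow> path measure \<Rightarrow> signal \<Rightarrow> path measure" where
  "observation_law d \<epsilon> M f = distr M (path_space d) (observation d \<epsilon> f)"

definition selection_rule :: "nat \<Rightarrow> signal set \<Rightarrow> (path \<Rightarrow> signal) \<Rightarrow> bool" where
  "selection_rule d \<F> T \<longleftrightarrow> T \<in> measurable (path_space d) (count_space \<F>)"

definition risk :: "nat \<Rightarrow> real \<Rightarrow> path measure \<Rightarrow> ereal \<Rightarrow> (path \<Rightarrow> signal) \<Rightarrow> signal \<Rightarrow> real" where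
  "risk d \<epsilon> M p T f = (LINT y|observation_law d \<epsilon> M f. Lp_dist d p (T y) f)"


section \<open>Families and their characteristics\<close>

text \<open>Distinctness is meant in the sense of function spaces, i.e. up to null sets; this makes all
  denominators below nonzero.\<close>

definition distinct_family :: "nat \<Rightarrow> nat \<Rightarrow> (nat \<Rightarrow> signal) \<Rightarrow> bool" where
  "distinct_family d N F \<longleftrightarrow>
     (\<forall>i\<in>{1..N}. \<forall>j\<in>{1..N}. i \<noteq> j \<longrightarrow> \<not> (AE u in cube_measure d. F i u = F j u))"

definition i_star :: "nat \<Rightarrow> nat \<Rightarrow> (nat \<Rightarrow> signal) \<Rightarrow> signal \<Rightarrow> ereal \<Rightarrow> nat" where
  "i_star d N F f p = arg_min_on (\<lambda>i. Lp_dist d p f (F i)) {1..N}"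

definition Q1 :: "nat \<Rightarrow> nat \<Rightarrow> (nat \<Rightarrow> signal) \<Rightarrow> signal \<Rightarrow> real \<Rightarrow> real" where
  "Q1 d N F f p =
     (if p \<le> 2 then 1
      else let k = i_star d N F f (ereal p) in
        Max ((\<lambda>i. (Lp_dist d (ereal (2 * p - 2)) (F k) (F i) / Lp_dist d (ereal p) (F k) (F i))
                    powr (p - 1)) ` ({1..N} - {k})))"

definition Q3 :: "nat \<Rightarrow> nat \<Rightarrow> (nat \<Rightarrow> signal) \<Rightarrow> signal \<Rightarrow> ereal \<Rightarrow> real" where
  "Q3 d N F f p =
     (let k = i_star d N F f p in
        Max ((\<lambda>i. Lp_dist d p (F k) (F i) / Lp_dist d 2 (F k) (F i)) ` ({1..N} - {k})))"

definition S_diff :: "nat \<Rightarrow> (nat \<Rightarrow> signal) \<Rightarrow> nat \<Rightarrow> nat \<Rightarrow> real \<Rightarrow> signal" where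
  "S_diff d F k i \<gamma> = (\<lambda>u. max (\<bar>F k u - F i u\<bar> - Lp_dist d \<infinity> (F k) (F i) + \<gamma>) 0)"

definition Q4 :: "nat \<Rightarrow> nat \<Rightarrow> (nat \<Rightarrow> signal) \<Rightarrow> signal \<Rightarrow> real \<Rightarrow> real" where
  "Q4 d N F f \<gamma> =
     (let k = i_star d N F f \<infinity> in
        Max ((\<lambda>i. Lp_norm d 2 (S_diff d F k i \<gamma>) / Lp_norm d 1 (S_diff d F k i \<gamma>))
              ` ({1..N} - {k})))"

text \<open>
  The thresholds for which \<open>S_diff\<close> really truncates: \<open>\<gamma>\<close> does not exceed any of the sup-norms
  it is compared with. For larger \<open>\<gamma>\<close>, \<open>S_diff\<close> has a positive constant part, and \<open>Q4\<close> tends to 1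
  as \<open>\<gamma>\<close> grows, whatever the family.
\<close>

definition admissible_level :: "nat \<Rightarrow> nat \<Rightarrow> (nat \<Rightarrow> signal) \<Rightarrow> signal \<Rightarrow> real \<Rightarrow> bool" where
  "admissible_level d N F f \<gamma> \<longleftrightarrow>
     0 < \<gamma> \<and>
     (let k = i_star d N F f \<infinity> in \<forall>i\<in>{1..N} - {k}. \<gamma> \<le> Lp_dist d \<infinity> (F k) (F i))"

end

theory Submission
  imports Defs
begin

text \<open>
  The family consists of \<open>N\<close> bumps of equal height \<open>A\<close> carried by the \<open>N\<close> disjoint slabs into
  which the hyperplanes \<open>u\<^sub>0 = i / N\<close> cut the cube. The difference of two members has modulus
  \<open>A\<close> on a set of measure \<open>m = 2 / N\<close> and vanishes elsewhere, so every pair has the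
  \<open>q\<close>-distance \<open>A m\<^bsup>1/q\<^esup>\<close>, and each of the ratios \<open>Q1\<close>, \<open>Q3\<close>, \<open>Q4\<close> is a maximum over equal
  terms with value \<open>m\<^bsup>1/q - 1/2\<^esup>\<close>; truncation at a level \<open>\<gamma> \<le> A\<close> only replaces the height
  \<open>A\<close> by \<open>\<gamma>\<close>.

  Since the family is equidistant, the excess risk of a selection rule at a member is this distance
  times the probability of not selecting that member. In the observation, a bump is a shift of the
  Wiener process with signal-to-noise ratio \<open>b = A / (\<epsilon> \<surd>N)\<close>. If \<open>P\<^sub>i\<close> is the law of the
  observation under bump \<open>i\<close> and \<open>P\<^sub>0\<close> the law of pure noise, then for every \<open>s > 0\<close> and every
  event \<open>E\<close>
  \<open>P\<^sub>i(E) \<le> s/2 P\<^sub>0(E) + exp(b\<^sup>2) / (2s)\<close>.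
  Applied to the disjoint events that the rule selects \<open>i\<close>, summed over \<open>i\<close> and optimised in
  \<open>s\<close>, this bounds the sum of the success probabilities by \<open>\<surd>N exp(b\<^sup>2/2)\<close>
  (\<open>sum_detection_prob_le\<close>). With \<open>b\<^sup>2 = ln (N - 1) / 2\<close> the sum is at most \<open>N\<^bsup>3/4\<^esup>\<close>, so for
  \<open>N > 3\<close> some member is missed with probability at least \<open>1/4\<close>. The restriction on \<open>\<epsilon>\<close> is
  what keeps the corresponding height \<open>A\<close> below \<open>L\<close>.

  The inequality between \<open>P\<^sub>i\<close> and \<open>P\<^sub>0\<close> is a weak form of the Cameron-Martin theorem and
  reduces to one dimension. If \<open>X\<close> is a linear functional of the Wiener process \<open>w\<close>, with
  variance \<open>v > 0\<close> and covariance \<open>h(t)\<close> with \<open>w(t)\<close>, then \<open>w\<close> has the same law as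
  \<open>w - h X / v + h z / \<surd>v\<close> with an independent standard normal \<open>z\<close> (\<open>wiener_law_split\<close>),
  and a shift in direction \<open>h\<close> is a shift of \<open>z\<close> alone (\<open>wiener_shift_prob_le\<close>). The equality
  of the two laws rests on the fact that a law on a product of real lines, with any number of
  factors, is determined by the characteristic functions of the finite linear forms
  (\<open>PiM_borel_eqI_char\<close>).
\<close>



section \<open>Characteristic functions determine laws on product spaces\<close>

text \<open>
  Normalising a bounded weight turns it into a probability density. This brings weighted measures
  within the reach of the uniqueness theorem for characteristic functions, which is about
  probability laws on the real line.
\<close>
lemma weighted_distr_char:
  fixes X W :: "'a \<Rightarrow> real"
  assumes M: "prob_space M"
    and X [measurable]: "X \<in> borel_measurable M" and W [measurable]: "W \<in> borel_measurable M"
    and W0: "\<And>w. 0 \<le> W w" and WC: "\<And>w. W w \<le> C"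
    and m: "m = (LINT w|M. W w)" "0 < m"
  defines "\<nu> \<equiv> distr (density M (\<lambda>w. ennreal (W w / m))) borel X"
  shows "real_distribution \<nu>"
    and "char \<nu> s = (CLINT w|M. of_real (W w) * iexp (s * X w)) / of_real m"
    and "B \<in> sets borel \<Longrightarrow> measure \<nu> B = (LINT w|M. W w * indicator B (X w)) / m"
proof -
  interpret prob_space M by fact
  have intW: "integrable M W"
    by (intro integrable_const_bound[of _ C]) (auto simp: W0 WC)
  have "emeasure (density M (\<lambda>w. ennreal (W w / m))) (space M) = (\<integral>\<^sup>+w. ennreal (W w / m) \<partial>M)"
    by (subst emeasure_density) (auto intro!: nn_integral_cong)
  also have "\<dots> = ennreal (LINT w|M. W w / m)"
    using m W0 intW by (intro nn_integral_eq_integral) auto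
  also have "\<dots> = 1" using m by simp
  finally have one: "emeasure (density M (\<lambda>w. ennreal (W w / m))) (space M) = 1" .
  interpret D: prob_space "density M (\<lambda>w. ennreal (W w / m))"
    by (rule prob_spaceI) (simp add: one)
  have "prob_space \<nu>" unfolding \<nu>_def by (rule D.prob_space_distr) simp
  then show rd: "real_distribution \<nu>"
    by (simp add: real_distribution_def real_distribution_axioms_def \<nu>_def)
  have "char \<nu> s = (CLINT w|M. (W w / m) *\<^sub>R iexp (s * X w))"
    unfolding char_def \<nu>_def
    using m W0 by (subst integral_distr) (auto intro!: integral_density)
  also have "\<dots> = (CLINT w|M. (of_real (W w) * iexp (s * X w)) / of_real m)"
    by (intro Bochner_Integration.integral_cong) (auto simp: scaleR_conv_of_real)
  finally show "char \<nu> s = (CLINT w|M. of_real (W w) * iexp (s * X w)) / of_real m"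
    by simp
  assume B [measurable]: "B \<in> sets borel"
  have "measure \<nu> B = (LINT x|\<nu>. indicator B x)"
    using rd by (simp add: \<nu>_def)
  also have "\<dots> = (LINT w|density M (\<lambda>w. ennreal (W w / m)). indicator B (X w))"
    unfolding \<nu>_def by (subst integral_distr) auto
  also have "\<dots> = (LINT w|M. (W w / m) *\<^sub>R indicator B (X w))"
    using m W0 by (intro integral_density) auto
  also have "\<dots> = (LINT w|M. W w * indicator B (X w) / m)"
    by (intro Bochner_Integration.integral_cong) auto
  finally show "measure \<nu> B = (LINT w|M. W w * indicator B (X w)) / m" by simp
qed

text \<open>
  The hypothesis at \<open>s = 0\<close> says that both weighted measures have the same total mass. If it is
  zero, the weight vanishes almost everywhere; otherwise the normalised laws of \<open>X\<close> have equal
  characteristic functions.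
\<close>
lemma weighted_integral_eqI_char:
  fixes X W :: "'a \<Rightarrow> real"
  assumes M: "prob_space M" and N: "prob_space N" and s: "sets N = sets M"
    and X: "X \<in> borel_measurable M" and W: "W \<in> borel_measurable M"
    and W0: "\<And>w. 0 \<le> W w" and WC: "\<And>w. W w \<le> C"
    and ch: "\<And>s. (CLINT w|M. of_real (W w) * iexp (s * X w)) = (CLINT w|N. of_real (W w) * iexp (s * X w))"
    and B: "B \<in> sets borel"
  shows "(LINT w|M. W w * indicator B (X w)) = (LINT w|N. W w * indicator B (X w))"
proof -
  interpret M: prob_space M by fact
  interpret N: prob_space N by fact
  have XN: "X \<in> borel_measurable N" and WN: "W \<in> borel_measurable N"
    using X W measurable_cong_sets[OF s refl] by auto
  note [measurable] = X W XN WN B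
  define m where "m = (LINT w|M. W w)"
  have mN: "m = (LINT w|N. W w)"
    using ch[of 0] by (simp add: m_def)
  have int: "integrable M W" "integrable N W"
    by (auto intro!: M.integrable_const_bound[of _ C] N.integrable_const_bound[of _ C] simp: W0 WC)
  have m0: "0 \<le> m" by (simp add: m_def W0)
  show ?thesis
  proof (cases "m = 0")
    case True
    have "AE w in M. W w = 0"
      using integral_nonneg_eq_0_iff_AE[OF int(1)] True W0 by (simp add: m_def)
    then have "(LINT w|M. W w * indicator B (X w)) = 0"
      by (intro integral_eq_zero_AE) auto
    moreover have "AE w in N. W w = 0"
      using integral_nonneg_eq_0_iff_AE[OF int(2)] True W0 by (simp add: mN)
    then have "(LINT w|N. W w * indicator B (X w)) = 0"
      by (intro integral_eq_zero_AE) auto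
    ultimately show ?thesis by simp
  next
    case False
    with m0 have m: "0 < m" by simp
    note tM = weighted_distr_char[OF M X W W0 WC m_def m]
    note tN = weighted_distr_char[OF N XN WN W0 WC mN m]
    have "distr (density M (\<lambda>w. ennreal (W w / m))) borel X
        = distr (density N (\<lambda>w. ennreal (W w / m))) borel X"
      by (intro Levy_uniqueness tM(1) tN(1) ext) (simp only: tM(2) tN(2) ch)
    with tM(3)[OF B] tN(3)[OF B] show ?thesis using m by simp
  qed
qed

text \<open>
  Coordinates are added to the cylinder one at a time, each by one-dimensional uniqueness for the
  law of \<open>X k\<close> weighted by the rest. The factor \<open>iexp (l w)\<close> keeps the induction going: it is
  not a positive weight, but it is a combination of the positive weights \<open>1\<close>, \<open>1 + cos (l w)\<close>
  and \<open>1 + sin (l w)\<close>, and multiplying these by \<open>iexp (s * X k w)\<close> leads only to exponentials of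
  \<open>s X k\<close> and \<open>s X k \<plusminus> l\<close>, which the induction hypothesis covers because \<open>L\<close> is closed under
  linear combinations.
\<close>
lemma char_eq_imp_cylinder_char_eq:
  fixes L :: "('a \<Rightarrow> real) set"
  assumes M: "prob_space M" and N: "prob_space N" and s: "sets N = sets M"
    and meas: "\<And>l. l \<in> L \<Longrightarrow> l \<in> borel_measurable M"
    and add: "\<And>l l'. l \<in> L \<Longrightarrow> l' \<in> L \<Longrightarrow> (\<lambda>w. l w + l' w) \<in> L"
    and scale: "\<And>r l. l \<in> L \<Longrightarrow> (\<lambda>w. r * l w) \<in> L"
    and ch: "\<And>l. l \<in> L \<Longrightarrow> (CLINT w|M. iexp (l w)) = (CLINT w|N. iexp (l w))"
    and "finite K" "\<And>k. k \<in> K \<Longrightarrow> X k \<in> L" "\<And>k. k \<in> K \<Longrightarrow> B k \<in> sets borel" "l \<in> L"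
  shows "(CLINT w|M. of_real (\<Prod>k\<in>K. indicator (B k) (X k w)) * iexp (l w))
       = (CLINT w|N. of_real (\<Prod>k\<in>K. indicator (B k) (X k w)) * iexp (l w))"
  using \<open>finite K\<close> assms(9-)
proof (induction K arbitrary: l rule: finite_induct)
  case empty
  then show ?case using ch by simp
next
  case (insert k K)
  interpret M: prob_space M by fact
  interpret N: prob_space N by fact
  define g :: "'a \<Rightarrow> real" where "g = (\<lambda>w. \<Prod>k\<in>K. indicator (B k) (X k w))"
  have IH: "(CLINT w|M. of_real (g w) * iexp (l w)) = (CLINT w|N. of_real (g w) * iexp (l w))"
    if "l \<in> L" for l
    unfolding g_def using insert that by blast
  have Lb: "l \<in> borel_measurable M" "l \<in> borel_measurable N" if "l \<in> L" for l
    using meas[OF that] measurable_cong_sets[OF s refl] by auto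
  have B [measurable]: "B k \<in> sets borel" and XL: "X k \<in> L" and lL: "l \<in> L"
    using insert by auto
  have [measurable]: "X k \<in> borel_measurable M" "X k \<in> borel_measurable N"
     "l \<in> borel_measurable M" "l \<in> borel_measurable N" by (auto intro: Lb XL lL)
  have gm: "g \<in> borel_measurable M" unfolding g_def
  proof (rule borel_measurable_prod)
    fix j assume "j \<in> K"
    then have [measurable]: "X j \<in> borel_measurable M" "B j \<in> sets borel" 
      using insert.prems Lb by auto
    show "(\<lambda>w. indicator (B j) (X j w) :: real) \<in> borel_measurable M" by measurable
  qed
  then have gN: "g \<in> borel_measurable N" using measurable_cong_sets[OF s refl] by auto
  note [measurable] = gm gN
  have g01: "0 \<le> g w" "g w \<le> 1" for w
    unfolding g_def by (auto intro!: prod_nonneg prod_le_1 simp: indicator_def)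
  have gint: "integrable M (\<lambda>w. of_real (g w) * iexp (h w))" if "h \<in> borel_measurable M" for h
    using that by (intro M.integrable_const_bound[of _ 1]) (auto simp: norm_mult g01)
  have gintN: "integrable N (\<lambda>w. of_real (g w) * iexp (h w))" if "h \<in> borel_measurable N" for h
    using that by (intro N.integrable_const_bound[of _ 1]) (auto simp: norm_mult g01)
  \<comment> \<open>The common shape of the three characteristic functions: the weight \<open>1 + cos l\<close> has
    coefficients \<open>1/2, 1/2\<close>, the weight \<open>1 + sin l\<close> has \<open>1/(2i), -1/(2i)\<close>.\<close>
  have triple: "(CLINT w|M. of_real (g w) * iexp (s * X k w)
         + (a * (of_real (g w) * iexp (s * X k w + l w)) + b * (of_real (g w) * iexp (s * X k w + (-1) * l w))))
     = (CLINT w|N. of_real (g w) * iexp (s * X k w)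
         + (a * (of_real (g w) * iexp (s * X k w + l w)) + b * (of_real (g w) * iexp (s * X k w + (-1) * l w))))"
    for s :: real and a b :: complex
  proof -
    have L: "(\<lambda>w. s * X k w) \<in> L" "(\<lambda>w. s * X k w + l w) \<in> L" "(\<lambda>w. s * X k w + (-1) * l w) \<in> L"
      by (intro scale XL lL | rule add)+
    have i: "integrable M (\<lambda>w. of_real (g w) * iexp (s * X k w))"
            "integrable N (\<lambda>w. of_real (g w) * iexp (s * X k w))"
            "integrable M (\<lambda>w. of_real (g w) * iexp (s * X k w + l w))"
            "integrable N (\<lambda>w. of_real (g w) * iexp (s * X k w + l w))"
            "integrable M (\<lambda>w. of_real (g w) * iexp (s * X k w + (-1) * l w))"
            "integrable N (\<lambda>w. of_real (g w) * iexp (s * X k w + (-1) * l w))"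
      by (rule gint gintN, measurable)+
    note sim = Bochner_Integration.integral_add[OF i(1)] Bochner_Integration.integral_add[OF i(2)]
      Bochner_Integration.integral_add[OF integrable_mult_right[OF i(3)] integrable_mult_right[OF i(5)]]
      Bochner_Integration.integral_add[OF integrable_mult_right[OF i(4)] integrable_mult_right[OF i(6)]]
    show ?thesis
      by (subst sim, intro Bochner_Integration.integrable_add integrable_mult_right i,
          subst sim, intro Bochner_Integration.integrable_add integrable_mult_right i)
         (simp only: sim integral_mult_right_zero IH[OF L(1)] IH[OF L(2)] IH[OF L(3)])
  qed
  have cosb: "0 \<le> g w * (1 + cos (l w)) \<and> g w * (1 + cos (l w)) \<le> 2" for w
    using mult_mono[of "g w" 1 "1 + cos (l w)" 2] mult_nonneg_nonneg[of "g w" "1 + cos (l w)"]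
      g01[of w] cos_le_one[of "l w"] cos_ge_minus_one[of "l w"] by linarith
  have sinb: "0 \<le> g w * (1 + sin (l w)) \<and> g w * (1 + sin (l w)) \<le> 2" for w
    using mult_mono[of "g w" 1 "1 + sin (l w)" 2] mult_nonneg_nonneg[of "g w" "1 + sin (l w)"]
      g01[of w] sin_le_one[of "l w"] sin_ge_minus_one[of "l w"] by linarith
  have pl: "(LINT w|M. g w * indicator (B k) (X k w)) = (LINT w|N. g w * indicator (B k) (X k w))"
  proof (rule weighted_integral_eqI_char[OF M N s, where C = 1])
    show "(CLINT w|M. of_real (g w) * iexp (s * X k w)) = (CLINT w|N. of_real (g w) * iexp (s * X k w))" for s
      by (rule IH) (intro scale XL)
  qed (auto simp: g01)
  have ex1: "iexp (s * X k w + l w) = iexp (s * X k w) * iexp (l w)" for s w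
    by (simp add: exp_add distrib_left)
  have ex2: "iexp (s * X k w + (-1) * l w) = iexp (s * X k w) * exp (- (\<i> * of_real (l w)))" for s w
    by (simp add: exp_add[symmetric] algebra_simps)
  have exc: "complex_of_real (cos (l w)) = (iexp (l w) + exp (- (\<i> * of_real (l w)))) / 2" for w
    by (simp add: cos_exp_eq cos_of_real[symmetric] del: cos_of_real)
  have exs: "complex_of_real (sin (l w)) = (iexp (l w) - exp (- (\<i> * of_real (l w)))) / (2 * \<i>)" for w
    by (simp add: sin_exp_eq sin_of_real[symmetric] del: sin_of_real)
  have co: "(LINT w|M. (g w * (1 + cos (l w))) * indicator (B k) (X k w))
          = (LINT w|N. (g w * (1 + cos (l w))) * indicator (B k) (X k w))"
  proof (rule weighted_integral_eqI_char[OF M N s, where C = 2])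
    have "of_real (g w * (1 + cos (l w))) * iexp (s * X k w) = of_real (g w) * iexp (s * X k w)
         + (1/2 * (of_real (g w) * iexp (s * X k w + l w)) + 1/2 * (of_real (g w) * iexp (s * X k w + (-1) * l w)))" for s w
      unfolding ex1 ex2 by (simp only: exc of_real_mult of_real_add of_real_1) (simp add: algebra_simps)
    then show "(CLINT w|M. of_real (g w * (1 + cos (l w))) * iexp (s * X k w))
        = (CLINT w|N. of_real (g w * (1 + cos (l w))) * iexp (s * X k w))" for s
      by (simp only: triple)
    show "g w * (1 + cos (l w)) \<le> 2" for w
      using cosb[of w] by linarith
    show "0 \<le> g w * (1 + cos (l w))" for w
      using cosb[of w] by linarith
  qed auto
  have si: "(LINT w|M. (g w * (1 + sin (l w))) * indicator (B k) (X k w))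
          = (LINT w|N. (g w * (1 + sin (l w))) * indicator (B k) (X k w))"
  proof (rule weighted_integral_eqI_char[OF M N s, where C = 2])
    have "of_real (g w * (1 + sin (l w))) * iexp (s * X k w) = of_real (g w) * iexp (s * X k w)
         + (1/(2*\<i>) * (of_real (g w) * iexp (s * X k w + l w)) + (-1/(2*\<i>)) * (of_real (g w) * iexp (s * X k w + (-1) * l w)))" for s w
      unfolding ex1 ex2 by (simp only: exs of_real_mult of_real_add of_real_1) (simp add: algebra_simps diff_divide_distrib)
    then show "(CLINT w|M. of_real (g w * (1 + sin (l w))) * iexp (s * X k w))
        = (CLINT w|N. of_real (g w * (1 + sin (l w))) * iexp (s * X k w))" for s
      by (simp only: triple)
    show "g w * (1 + sin (l w)) \<le> 2" for w
      using sinb[of w] by linarith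
    show "0 \<le> g w * (1 + sin (l w))" for w
      using sinb[of w] by linarith
  qed auto
  have split: "(CLINT w|P. of_real (indicator (B k) (X k w) * g w) * iexp (l w)) =
      of_real ((LINT w|P. (g w * (1 + cos (l w))) * indicator (B k) (X k w)) - (LINT w|P. g w * indicator (B k) (X k w)))
      + \<i> * of_real ((LINT w|P. (g w * (1 + sin (l w))) * indicator (B k) (X k w)) - (LINT w|P. g w * indicator (B k) (X k w)))"
    if P: "prob_space P" and [measurable]: "g \<in> borel_measurable P" "l \<in> borel_measurable P" "X k \<in> borel_measurable P" for P
  proof -
    interpret P: prob_space P by fact
    have i: "integrable P (\<lambda>w. g w * indicator (B k) (X k w))"
        "integrable P (\<lambda>w. (g w * (1 + cos (l w))) * indicator (B k) (X k w))"
        "integrable P (\<lambda>w. (g w * (1 + sin (l w))) * indicator (B k) (X k w))"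
      by (rule P.integrable_const_bound[of _ 2];
          use g01 cosb sinb in \<open>auto simp: indicator_def intro!: AE_I2 order_trans[OF g01(2)]\<close>)+
    have "(CLINT w|P. of_real (indicator (B k) (X k w) * g w) * iexp (l w)) =
       (CLINT w|P. of_real ((g w * (1 + cos (l w))) * indicator (B k) (X k w) - g w * indicator (B k) (X k w))
       + \<i> * of_real ((g w * (1 + sin (l w))) * indicator (B k) (X k w) - g w * indicator (B k) (X k w)))"
      by (intro Bochner_Integration.integral_cong refl)
         (simp add: exp_Euler algebra_simps sin_of_real cos_of_real)
    also have "\<dots> = (CLINT w|P. of_real ((g w * (1 + cos (l w))) * indicator (B k) (X k w) - g w * indicator (B k) (X k w)))
       + \<i> * (CLINT w|P. of_real ((g w * (1 + sin (l w))) * indicator (B k) (X k w) - g w * indicator (B k) (X k w)))"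
      using i by (subst Bochner_Integration.integral_add)
         (auto intro!: integrable_mult_right Bochner_Integration.integrable_diff simp del: of_real_diff of_real_mult)
    also have "\<dots> = of_real (LINT w|P. (g w * (1 + cos (l w))) * indicator (B k) (X k w) - g w * indicator (B k) (X k w))
       + \<i> * of_real (LINT w|P. (g w * (1 + sin (l w))) * indicator (B k) (X k w) - g w * indicator (B k) (X k w))"
      by (simp only: integral_complex_of_real)
    also have "\<dots> = of_real ((LINT w|P. (g w * (1 + cos (l w))) * indicator (B k) (X k w)) - (LINT w|P. g w * indicator (B k) (X k w)))
      + \<i> * of_real ((LINT w|P. (g w * (1 + sin (l w))) * indicator (B k) (X k w)) - (LINT w|P. g w * indicator (B k) (X k w)))"
      by (simp only: Bochner_Integration.integral_diff[OF i(2) i(1)] Bochner_Integration.integral_diff[OF i(3) i(1)])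
    finally show ?thesis .
  qed
  have "(CLINT w|M. of_real (indicator (B k) (X k w) * g w) * iexp (l w))
      = (CLINT w|N. of_real (indicator (B k) (X k w) * g w) * iexp (l w))"
    by (subst split[OF M], measurable, subst split[OF N], measurable) (simp only: pl co si)
  then show ?case
    using insert.hyps by (simp add: g_def)
qed

text \<open>
  Cylinders over Borel rectangles generate the product sigma-algebra and are closed under
  intersection, so agreement on them suffices; it is the preceding lemma for \<open>L\<close> the finite linear
  forms in the coordinates and \<open>l = 0\<close>.
\<close>
lemma PiM_borel_eqI_char:
  fixes M N :: "('i \<Rightarrow> real) measure"
  assumes M: "prob_space M" and N: "prob_space N"
    and sM: "sets M = sets (Pi\<^sub>M I (\<lambda>_. borel))" and sN: "sets N = sets (Pi\<^sub>M I (\<lambda>_. borel))"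
    and ch: "\<And>J a. finite J \<Longrightarrow> J \<subseteq> I \<Longrightarrow>
       (CLINT w|M. iexp (\<Sum>t\<in>J. a t * w t)) = (CLINT w|N. iexp (\<Sum>t\<in>J. a t * w t))"
  shows "M = N"
proof (rule measure_eqI_PiM_infinite[OF sM sN])
  show "finite_measure M" using M by (rule prob_space.finite_measure)
next
  fix B :: "'i \<Rightarrow> real set" and J assume J: "finite J" "J \<subseteq> I" and B: "\<And>i. i \<in> J \<Longrightarrow> B i \<in> sets borel"
  interpret M: prob_space M by fact
  interpret N: prob_space N by fact
  define L :: "(('i \<Rightarrow> real) \<Rightarrow> real) set"
    where "L = {l. \<exists>J a. finite J \<and> J \<subseteq> I \<and> l = (\<lambda>w. \<Sum>t\<in>J. a t * w t)}"
  have LI: "(\<lambda>w. \<Sum>t\<in>J. a t * w t) \<in> L" if "finite J" "J \<subseteq> I" for J a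
    using that by (auto simp: L_def)
  have sp: "space M = PiE I (\<lambda>_. UNIV)" "space N = PiE I (\<lambda>_. UNIV)"
    using sets_eq_imp_space_eq[OF sM] sets_eq_imp_space_eq[OF sN] by (auto simp: space_PiM)
  have coord: "(\<lambda>w. w t) \<in> borel_measurable M" if "t \<in> I" for t
    using measurable_component_singleton[OF that, of "\<lambda>_. borel"] measurable_cong_sets[OF sM refl] by auto
  have "(CLINT w|M. of_real (\<Prod>k\<in>J. indicator (B k) (w k)) * iexp ((\<lambda>w. \<Sum>t\<in>{}. 0 * w t) w))
      = (CLINT w|N. of_real (\<Prod>k\<in>J. indicator (B k) (w k)) * iexp ((\<lambda>w. \<Sum>t\<in>{}. 0 * w t) w))"
  proof (rule char_eq_imp_cylinder_char_eq[OF M N, where L = L and X = "\<lambda>k w. w k"])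
    fix l l' assume "l \<in> L" "l' \<in> L"
    then obtain J a J' a' where *: "finite J" "J \<subseteq> I" "l = (\<lambda>w. \<Sum>t\<in>J. a t * w t)"
      "finite J'" "J' \<subseteq> I" "l' = (\<lambda>w. \<Sum>t\<in>J'. a' t * w t)" by (auto simp: L_def)
    have "(\<lambda>w. l w + l' w) = (\<lambda>w. \<Sum>t\<in>J \<union> J'. ((if t \<in> J then a t else 0) + (if t \<in> J' then a' t else 0)) * w t)"
    proof
      fix w :: "'i \<Rightarrow> real"
      have "l w = (\<Sum>t\<in>J \<union> J'. (if t \<in> J then a t else 0) * w t)"
        using * by (subst sum.mono_neutral_cong_right[of "J \<union> J'" J _ "\<lambda>t. a t * w t"]) auto
      moreover have "l' w = (\<Sum>t\<in>J \<union> J'. (if t \<in> J' then a' t else 0) * w t)"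
        using * by (subst sum.mono_neutral_cong_right[of "J \<union> J'" J' _ "\<lambda>t. a' t * w t"]) auto
      ultimately show "l w + l' w = (\<Sum>t\<in>J \<union> J'. ((if t \<in> J then a t else 0) + (if t \<in> J' then a' t else 0)) * w t)"
        by (simp add: distrib_right sum.distrib)
    qed
    then show "(\<lambda>w. l w + l' w) \<in> L" using *(1,2,4,5) by (auto intro!: LI)
  next
    fix r l assume "l \<in> L"
    then obtain J a where *: "finite J" "J \<subseteq> I" "l = (\<lambda>w. \<Sum>t\<in>J. a t * w t)" by (auto simp: L_def)
    then have "(\<lambda>w. r * l w) = (\<lambda>w. \<Sum>t\<in>J. (r * a t) * w t)"
      by (simp add: sum_distrib_left mult.assoc)
    then show "(\<lambda>w. r * l w) \<in> L" using LI[OF *(1,2)] by simp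
  next
    fix l assume "l \<in> L" 
    then obtain J a where *: "finite J" "J \<subseteq> I" "l = (\<lambda>w. \<Sum>t\<in>J. a t * w t)" by (auto simp: L_def)
    show "l \<in> borel_measurable M"
      unfolding *(3) using *(2) coord by (intro borel_measurable_sum borel_measurable_times) auto
  next
    fix l assume "l \<in> L"
    then show "(CLINT w|M. iexp (l w)) = (CLINT w|N. iexp (l w))"
      using ch by (auto simp: L_def)
  next
    fix k assume "k \<in> J"
    then show "(\<lambda>w. w k) \<in> L" using J LI[of "{k}" "\<lambda>_. 1"] by auto
  qed (use J B LI[of "{}"] sM sN in auto)
  then have "complex_of_real (LINT w|M. (\<Prod>k\<in>J. indicator (B k) (w k))) = of_real (LINT w|N. (\<Prod>k\<in>J. indicator (B k) (w k)))"
    by (simp del: of_real_prod)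
  then have eq: "(LINT w|M. (\<Prod>k\<in>J. indicator (B k) (w k) :: real)) = (LINT w|N. (\<Prod>k\<in>J. indicator (B k) (w k)))"
    by (simp only: of_real_eq_iff)
  let ?E = "prod_emb I (\<lambda>_. borel) J (Pi\<^sub>E J B)"
  have E: "?E \<in> sets M" "?E \<in> sets N"
    unfolding sM sN using J B by (auto intro!: sets_PiM_I)
  have ind: "(\<Prod>k\<in>J. indicator (B k) (w k) :: real) = indicator ?E w" if "w \<in> PiE I (\<lambda>_. UNIV)" for w
    using J that by (force simp: prod_emb_def indicator_def prod_zero_iff Pi_iff intro!: prod.neutral)
  have "(LINT w|M. (\<Prod>k\<in>J. indicator (B k) (w k) :: real)) = (LINT w|M. indicator ?E w)"
    by (intro Bochner_Integration.integral_cong ind) (auto simp: sp)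
  moreover have "(LINT w|N. (\<Prod>k\<in>J. indicator (B k) (w k) :: real)) = (LINT w|N. indicator ?E w)"
    by (intro Bochner_Integration.integral_cong ind) (auto simp: sp)
  ultimately have "measure M ?E = measure N ?E"
    using eq E by (simp add: sets.Int_space_eq2)
  then show "emeasure M ?E = emeasure N ?E"
    by (simp add: M.emeasure_eq_measure N.emeasure_eq_measure)
qed


section \<open>The covariance of the Wiener process\<close>

lemma prob_space_unit_interval: "prob_space (restrict_space lborel {0..1::real})"
  by (rule prob_spaceI) (simp add: space_restrict_space emeasure_restrict_space)

lemma prob_space_cube: "prob_space (cube_measure d)"
  unfolding cube_measure_def by (intro prob_space_PiM prob_space_unit_interval)

lemma space_cube: "space (cube_measure d) = unit_cube d"
  by (simp add: cube_measure_def unit_cube_def space_PiM space_restrict_space)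

definition lower_box :: "nat \<Rightarrow> point \<Rightarrow> point set" where
  "lower_box d t = {u \<in> unit_cube d. \<forall>i<d. u i \<le> t i}"

text \<open>
  The covariance of the Wiener process is the \<open>L\<^sub>2\<close> inner product of the indicators of the boxes
  below \<open>s\<close> and \<open>t\<close>. Positivity of the covariance, the measures of the slabs and their drifts all
  come from this identity.
\<close>
lemma
  assumes s: "s \<in> unit_cube d" and t: "t \<in> unit_cube d"
  shows sets_lower_box_Int: "lower_box d s \<inter> lower_box d t \<in> sets (cube_measure d)"
    and measure_lower_box_Int: "measure (cube_measure d) (lower_box d s \<inter> lower_box d t) = wiener_cov d s t"
proof -
  interpret U: prob_space "restrict_space lborel {0..1::real}" by (rule prob_space_unit_interval)
  interpret finite_product_prob_space "\<lambda>_. restrict_space lborel {0..1::real}" "{..<d}"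
    by standard auto
  let ?A = "\<lambda>i. {0..min (s i) (t i)}"
  have st: "s i \<in> {0..1}" "t i \<in> {0..1}" if "i < d" for i
    using s t that unfolding unit_cube_def by (blast intro: PiE_mem)+
  have eq: "lower_box d s \<inter> lower_box d t = PiE {..<d} ?A"
  proof (rule set_eqI)
    fix u
    have "(\<forall>i<d. u i \<in> {0..1}) \<and> (\<forall>i<d. u i \<le> s i) \<and> (\<forall>i<d. u i \<le> t i) \<longleftrightarrow> (\<forall>i<d. u i \<in> ?A i)"
      using st by (meson atLeastAtMost_iff min.bounded_iff order_trans)
    then show "u \<in> lower_box d s \<inter> lower_box d t \<longleftrightarrow> u \<in> PiE {..<d} ?A"
      by (auto simp: lower_box_def unit_cube_def PiE_iff)
  qed
  have A: "?A i \<in> sets (restrict_space lborel {0..1::real})" if "i < d" for i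
    using st[OF that] by (subst sets_restrict_space_iff) auto
  show "lower_box d s \<inter> lower_box d t \<in> sets (cube_measure d)"
    unfolding eq cube_measure_def using A by (intro sets_PiM_I_finite) auto
  have "measure (cube_measure d) (PiE {..<d} ?A) = (\<Prod>i<d. measure (restrict_space lborel {0..1::real}) (?A i))"
    unfolding cube_measure_def using A by (intro finite_measure_PiM_emb) auto
  also have "\<dots> = (\<Prod>i<d. min (s i) (t i))"
    using st by (intro prod.cong refl) (subst measure_restrict_space; auto simp: min_def)
  finally show "measure (cube_measure d) (lower_box d s \<inter> lower_box d t) = wiener_cov d s t"
    by (simp add: eq wiener_cov_def)
qed

lemma sets_lower_box: "t \<in> unit_cube d \<Longrightarrow> lower_box d t \<in> sets (cube_measure d)"
  using sets_lower_box_Int[of t d t] by simp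

lemma wiener_cov_commute: "wiener_cov d s t = wiener_cov d t s"
  by (simp add: wiener_cov_def min.commute)

text \<open>
  The covariance of the linear functionals of the Wiener process with coefficients \<open>a\<close> and
  \<open>b\<close>.
\<close>
definition wiener_inner :: "nat \<Rightarrow> point set \<Rightarrow> (point \<Rightarrow> real) \<Rightarrow> (point \<Rightarrow> real) \<Rightarrow> real" where
  "wiener_inner d J a b = (\<Sum>s\<in>J. \<Sum>t\<in>J. a s * b t * wiener_cov d s t)"

text \<open>
  The value is the squared \<open>L\<^sub>2\<close> norm of the combination of box indicators with coefficients
  \<open>a\<close>. Nonnegativity is derived from the covariance itself because \<open>normal_law\<close> is meaningful
  for nonnegative variances only.
\<close>
lemma wiener_inner_nonneg:
  assumes "finite J" "J \<subseteq> unit_cube d"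
  shows "0 \<le> wiener_inner d J a a"
proof -
  interpret prob_space "cube_measure d" by (rule prob_space_cube)
  have "(LINT u|cube_measure d. (\<Sum>s\<in>J. a s * indicator (lower_box d s) u)\<^sup>2)
      = (LINT u|cube_measure d. (\<Sum>s\<in>J. \<Sum>t\<in>J. a s * a t * indicator (lower_box d s \<inter> lower_box d t) u))"
    by (intro Bochner_Integration.integral_cong refl)
      (auto simp: power2_eq_square sum_product indicator_inter_arith intro!: sum.cong)
  also have "\<dots> = (\<Sum>s\<in>J. \<Sum>t\<in>J. a s * a t * wiener_cov d s t)"
  proof -
    have "lower_box d s \<inter> lower_box d t \<in> events" "measure (cube_measure d) (lower_box d s \<inter> lower_box d t) = wiener_cov d s t"
      if "s \<in> J" "t \<in> J" for s t
      using that assms by (blast intro: sets_lower_box_Int measure_lower_box_Int subsetD)+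
    then show ?thesis
      by (simp add: Bochner_Integration.integral_sum Bochner_Integration.integrable_sum
          emeasure_eq_measure sets.Int_space_eq2 cong: sum.cong)
  qed
  finally have "wiener_inner d J a a = (LINT u|cube_measure d. (\<Sum>s\<in>J. a s * indicator (lower_box d s) u)\<^sup>2)"
    by (simp add: wiener_inner_def)
  then show ?thesis by simp
qed

lemma char_normal_law:
  assumes "0 \<le> v"
  shows "(CLINT x|normal_law 0 v. iexp x) = of_real (exp (- v / 2))"
proof (cases "v = 0")
  case True
  then show ?thesis by (simp add: normal_law_def integral_return)
next
  case False
  with assms have v: "0 < v" by simp
  then have sv: "0 < sqrt v" by simp
  have "(CLINT x|normal_law 0 v. iexp x) = (CLINT x|lborel. normal_density 0 (sqrt v) x *\<^sub>R iexp x)"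
    using False by (simp add: normal_law_def integral_density)
  also have "\<dots> = \<bar>sqrt v\<bar> *\<^sub>R (CLINT x|lborel. normal_density 0 (sqrt v) (0 + sqrt v * x) *\<^sub>R iexp (0 + sqrt v * x))"
    using sv by (subst lborel_integral_real_affine[where c = "sqrt v" and t = 0]) auto
  also have "\<dots> = (CLINT x|lborel. std_normal_density x *\<^sub>R iexp (sqrt v * x))"
    unfolding integral_scaleR_right[symmetric]
    using v by (intro Bochner_Integration.integral_cong refl)
       (simp add: normal_density_def real_sqrt_mult power_mult_distrib scaleR_conv_of_real)
  also have "\<dots> = char std_normal_distribution (sqrt v)"
    by (simp add: char_def integral_density)
  also have "\<dots> = of_real (exp (- v / 2))"
    using assms by (simp add: char_std_normal_distribution)
  finally show ?thesis .
qed

lemma wiener_char: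
  assumes M: "wiener_law d M" and J: "finite J" "J \<subseteq> unit_cube d"
  shows "(CLINT w|M. iexp (\<Sum>t\<in>J. a t * w t)) = of_real (exp (- wiener_inner d J a a / 2))"
proof -
  have sM: "sets M = sets (Pi\<^sub>M (unit_cube d) (\<lambda>_. borel))"
    using M by (simp add: wiener_law_def path_space_def)
  have [measurable]: "(\<lambda>w. w t) \<in> borel_measurable M" if "t \<in> unit_cube d" for t
    using measurable_component_singleton[OF that, of "\<lambda>_. borel"] measurable_cong_sets[OF sM refl] by auto
  have "(\<lambda>w. \<Sum>t\<in>J. a t * w t) \<in> borel_measurable M"
    using J by (intro borel_measurable_sum borel_measurable_times) auto
  then have "(CLINT w|M. iexp (\<Sum>t\<in>J. a t * w t)) = (CLINT x|distr M borel (\<lambda>w. \<Sum>t\<in>J. a t * w t). iexp x)"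
    by (subst integral_distr) auto
  also have "\<dots> = of_real (exp (- wiener_inner d J a a / 2))"
    using M J char_normal_law[OF wiener_inner_nonneg[OF J]] 
    by (simp add: wiener_law_def wiener_inner_def)
  finally show ?thesis .
qed


section \<open>Shifts of the Wiener process\<close>

text \<open>
  Extending coefficients by zero puts two linear forms with different index sets on a common one.
\<close>
lemma sum_extend_by_zero:
  fixes c :: "'a \<Rightarrow> real"
  assumes "finite T" "J \<subseteq> T"
  shows "(\<Sum>t\<in>T. (if t \<in> J then c t else 0) * f t) = (\<Sum>t\<in>J. c t * f t)"
  using assms by (intro sum.mono_neutral_cong_right) auto

lemma wiener_inner_extend_by_zero:
  assumes "finite T" "J \<subseteq> T" "S \<subseteq> T"
  shows "wiener_inner d T (\<lambda>t. if t \<in> J then c t else 0) (\<lambda>t. if t \<in> S then a t else 0)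
    = (\<Sum>t\<in>J. c t * (\<Sum>s\<in>S. a s * wiener_cov d s t))"
proof -
  have "wiener_inner d T (\<lambda>t. if t \<in> J then c t else 0) (\<lambda>t. if t \<in> S then a t else 0)
     = (\<Sum>t\<in>T. (if t \<in> J then c t else 0) * (\<Sum>s\<in>T. (if s \<in> S then a s else 0) * wiener_cov d s t))"
    by (simp add: wiener_inner_def sum_distrib_left mult.assoc wiener_cov_commute)
  then show ?thesis
    by (simp only: sum_extend_by_zero[OF assms(1,2)] sum_extend_by_zero[OF assms(1,3)])
qed

lemma wiener_inner_diff:
  "wiener_inner d T (\<lambda>t. c t - k * a t) (\<lambda>t. c t - k * a t)
    = wiener_inner d T c c - 2 * k * wiener_inner d T c a + k\<^sup>2 * wiener_inner d T a a"
proof -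
  have sym: "wiener_inner d T a c = wiener_inner d T c a"
    unfolding wiener_inner_def by (subst sum.swap) (simp add: wiener_cov_commute mult.commute)
  have "wiener_inner d T (\<lambda>t. c t - k * a t) (\<lambda>t. c t - k * a t)
    = wiener_inner d T c c - k * wiener_inner d T c a - k * wiener_inner d T a c + k\<^sup>2 * wiener_inner d T a a"
    unfolding wiener_inner_def sum_distrib_left sum_subtractf[symmetric] sum.distrib[symmetric]
    by (intro sum.cong refl) (simp add: algebra_simps power2_eq_square)
  then show ?thesis by (simp add: sym)
qed

text \<open>
  The function \<open>h\<close> is the covariance of \<open>X\<close> with the coordinates, so \<open>w - h X / v\<close> is
  uncorrelated with \<open>X\<close>, hence independent of it by normality, and \<open>X\<close> may be exchanged for an
  independent normal variable \<open>\<surd>v z\<close> without changing the law. On the level of characteristic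
  functions: a linear form with coefficients \<open>c\<close> loses the variance \<open>H\<^sup>2 / v\<close> when \<open>h X / v\<close> is
  subtracted, where \<open>H\<close> is its covariance with \<open>X\<close>, and regains exactly this from \<open>z\<close>.
\<close>
lemma wiener_law_split:
  fixes a :: "point \<Rightarrow> real"
  assumes M: "wiener_law d M" and S: "finite S" "S \<subseteq> unit_cube d"
  defines "X \<equiv> \<lambda>w. \<Sum>s\<in>S. a s * w s" and "v \<equiv> wiener_inner d S a a"
    and "h \<equiv> \<lambda>t. \<Sum>s\<in>S. a s * wiener_cov d s t"
  defines "\<Phi> \<equiv> \<lambda>(z, w). \<lambda>t\<in>unit_cube d. w t - h t / v * X w + h t / sqrt v * z"
  assumes v: "0 < v"
  shows "\<Phi> \<in> std_normal_distribution \<Otimes>\<^sub>M M \<rightarrow>\<^sub>M path_space d"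
    and "distr (std_normal_distribution \<Otimes>\<^sub>M M) (path_space d) \<Phi> = M"
proof -
  have sM: "sets M = sets (Pi\<^sub>M (unit_cube d) (\<lambda>_. borel))"
    using M by (simp add: wiener_law_def path_space_def)
  interpret M: prob_space M using M by (simp add: wiener_law_def)
  interpret Z: real_distribution std_normal_distribution by (rule real_dist_normal_dist)
  interpret ZM: pair_prob_space std_normal_distribution M ..
  have coord [measurable]: "(\<lambda>w. w t) \<in> borel_measurable M" if "t \<in> unit_cube d" for t
    using measurable_component_singleton[OF that, of "\<lambda>_. borel"] measurable_cong_sets[OF sM refl] by auto
  have lin: "(\<lambda>w. \<Sum>t\<in>J. c t * w t) \<in> borel_measurable M" if "J \<subseteq> unit_cube d" for J c
    using that by (intro borel_measurable_sum borel_measurable_times) auto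
  have X [measurable]: "X \<in> borel_measurable M"
    unfolding X_def by (rule lin[OF S(2)])
  show \<Phi> [measurable]: "\<Phi> \<in> std_normal_distribution \<Otimes>\<^sub>M M \<rightarrow>\<^sub>M path_space d"
    unfolding \<Phi>_def path_space_def case_prod_beta
    by (rule measurable_restrict) measurable
  show "distr (std_normal_distribution \<Otimes>\<^sub>M M) (path_space d) \<Phi> = M"
  proof (rule PiM_borel_eqI_char[symmetric, OF _ _ sM])
    show "prob_space M" by (rule M.prob_space_axioms)
    show "prob_space (distr (std_normal_distribution \<Otimes>\<^sub>M M) (path_space d) \<Phi>)"
      by (rule ZM.prob_space_distr) simp
    show "sets (distr (std_normal_distribution \<Otimes>\<^sub>M M) (path_space d) \<Phi>) = sets (Pi\<^sub>M (unit_cube d) (\<lambda>_. borel))"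
      by (simp add: path_space_def)
    fix J and c :: "point \<Rightarrow> real" assume J: "finite J" "J \<subseteq> unit_cube d"
    define H where "H = (\<Sum>t\<in>J. c t * h t)"
    define T where "T = J \<union> S"
    have T: "finite T" "J \<subseteq> T" "S \<subseteq> T" "T \<subseteq> unit_cube d" using J S by (auto simp: T_def)
    define c' where "c' = (\<lambda>t. if t \<in> J then c t else 0)"
    define a' where "a' = (\<lambda>t. if t \<in> S then a t else 0)"
    define b where "b = (\<lambda>t. c' t - H / v * a' t)"
    have "wiener_inner d T c' a' = H"
      unfolding c'_def a'_def H_def h_def using T by (intro wiener_inner_extend_by_zero)
    moreover have "wiener_inner d T a' a' = v"
      unfolding a'_def v_def using T
      by (subst wiener_inner_extend_by_zero)
         (auto simp: wiener_inner_def sum_distrib_left mult.assoc wiener_cov_commute)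
    moreover have "wiener_inner d T c' c' = wiener_inner d J c c"
      unfolding c'_def using T
      by (subst wiener_inner_extend_by_zero)
         (auto simp: wiener_inner_def sum_distrib_left mult.assoc wiener_cov_commute)
    ultimately have var: "wiener_inner d T b b = wiener_inner d J c c - H\<^sup>2 / v"
      using v unfolding b_def wiener_inner_diff by (simp add: field_simps power2_eq_square)
    have lin_b: "(\<Sum>t\<in>T. b t * w t) = (\<Sum>t\<in>J. c t * w t) - H / v * X w" for w
    proof -
      have "(\<Sum>t\<in>T. b t * w t) = (\<Sum>t\<in>T. c' t * w t) - H / v * (\<Sum>t\<in>T. a' t * w t)"
        by (simp add: b_def left_diff_distrib sum_subtractf sum_distrib_left mult.assoc)
      then show ?thesis
        unfolding c'_def a'_def X_def by (simp only: sum_extend_by_zero[OF T(1,2)] sum_extend_by_zero[OF T(1,3)])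
    qed
    have lin_\<Phi>: "(\<Sum>t\<in>J. c t * \<Phi> (z, w) t) = (\<Sum>t\<in>T. b t * w t) + H / sqrt v * z" for z w
    proof -
      have "(\<Sum>t\<in>J. c t * \<Phi> (z, w) t) = (\<Sum>t\<in>J. c t * w t - (c t * h t) * (X w / v) + (c t * h t) * (z / sqrt v))"
        using J by (intro sum.cong refl) (auto simp: \<Phi>_def algebra_simps)
      also have "\<dots> = (\<Sum>t\<in>J. c t * w t) - H * (X w / v) + H * (z / sqrt v)"
        by (simp only: sum.distrib sum_subtractf H_def sum_distrib_right)
      finally show ?thesis by (simp add: lin_b)
    qed
    have [measurable]: "(\<lambda>w. \<Sum>t\<in>T. b t * w t) \<in> borel_measurable M" by (rule lin[OF T(4)])
    have lin': "(\<lambda>w. \<Sum>t\<in>J. c t * w t) \<in> borel_measurable (path_space d)"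
      using lin[OF J(2), of c] unfolding path_space_def measurable_cong_sets[OF sM refl] .
    have "(CLINT w|distr (std_normal_distribution \<Otimes>\<^sub>M M) (path_space d) \<Phi>. iexp (\<Sum>t\<in>J. c t * w t))
        = (CLINT x|std_normal_distribution \<Otimes>\<^sub>M M. iexp (\<Sum>t\<in>J. c t * \<Phi> x t))"
      using lin' by (subst integral_distr) (auto simp del: of_real_sum)
    also have "\<dots> = (CLINT x|std_normal_distribution \<Otimes>\<^sub>M M. iexp (H / sqrt v * fst x) * iexp (\<Sum>t\<in>T. b t * snd x t))"
      by (intro Bochner_Integration.integral_cong refl)
         (simp only: lin_\<Phi>[of "fst x" "snd x" for x, unfolded prod.collapse] of_real_add distrib_left exp_add mult.commute[of "iexp (H / sqrt v * fst x)" for x])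
    also have "\<dots> = (CLINT z|std_normal_distribution. CLINT w|M. iexp (H / sqrt v * z) * iexp (\<Sum>t\<in>T. b t * w t))"
    proof (subst ZM.integral_fst'[symmetric])
      show "integrable (std_normal_distribution \<Otimes>\<^sub>M M) (\<lambda>x. iexp (H / sqrt v * fst x) * iexp (\<Sum>t\<in>T. b t * snd x t))"
        by (rule ZM.integrable_const_bound[of _ 1]) (auto simp: norm_mult simp del: of_real_sum of_real_mult)
    qed simp
    also have "\<dots> = char std_normal_distribution (H / sqrt v) * (CLINT w|M. iexp (\<Sum>t\<in>T. b t * w t))"
      unfolding char_def by (simp del: of_real_sum of_real_mult)
    also have "\<dots> = of_real (exp (- (H\<^sup>2 / v) / 2) * exp (- wiener_inner d T b b / 2))"
      using v by (subst wiener_char[OF M T(1,4)]) (simp add: char_std_normal_distribution power_divide)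
    also have "\<dots> = of_real (exp (- wiener_inner d J c c / 2))"
      unfolding var exp_add[symmetric] by (simp add: field_simps)
    also have "\<dots> = (CLINT w|M. iexp (\<Sum>t\<in>J. c t * w t))"
      by (rule wiener_char[OF M J, symmetric])
    finally show "(CLINT w|M. iexp (\<Sum>t\<in>J. c t * w t))
      = (CLINT w|distr (std_normal_distribution \<Otimes>\<^sub>M M) (path_space d) \<Phi>. iexp (\<Sum>t\<in>J. c t * w t))" ..
  qed
qed

text \<open>
  Let \<open>y\<close> be the likelihood ratio of the normal laws with means \<open>b\<close> and \<open>0\<close>. Then
  \<open>y \<le> s/2 + y\<^sup>2 / (2s)\<close>, because \<open>(y - s)\<^sup>2 \<ge> 0\<close>, and \<open>y\<^sup>2\<close> is \<open>exp (b\<^sup>2)\<close> times the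
  likelihood ratio of the means \<open>2b\<close> and \<open>0\<close>.
\<close>
lemma normal_density_shift_le:
  fixes b s :: real
  assumes s: "0 < s"
  shows "normal_density b 1 z \<le> s / 2 * std_normal_density z + exp (b\<^sup>2) / (2 * s) * normal_density (2 * b) 1 z"
proof -
  define y where "y = exp (b * z - b\<^sup>2 / 2)"
  have e1: "exp (- (z - b)\<^sup>2 / 2) = exp (- z\<^sup>2 / 2) * y"
    by (simp add: y_def exp_add[symmetric] power2_eq_square field_simps)
  have e2: "exp (b\<^sup>2) * exp (- (z - 2 * b)\<^sup>2 / 2) = exp (- z\<^sup>2 / 2) * y\<^sup>2"
    by (simp add: y_def exp_add[symmetric] power2_eq_square field_simps)
  have "0 \<le> (y - s)\<^sup>2" by simp
  then have "2 * s * y \<le> s\<^sup>2 + y\<^sup>2" by (simp add: power2_eq_square algebra_simps)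
  then have y: "y \<le> s / 2 + y\<^sup>2 / (2 * s)"
    using s by (simp add: field_simps power2_eq_square)
  have "normal_density b 1 z = std_normal_density z * y"
    using e1 by (simp add: normal_density_def)
  also have "\<dots> \<le> std_normal_density z * (s / 2 + y\<^sup>2 / (2 * s))"
    using y by (intro mult_left_mono) auto
  also have "\<dots> = s / 2 * std_normal_density z + (std_normal_density z * y\<^sup>2) / (2 * s)"
    by (simp add: algebra_simps)
  also have "std_normal_density z * y\<^sup>2 = exp (b\<^sup>2) * normal_density (2 * b) 1 z"
    using e2 by (simp add: normal_density_def)
  finally show ?thesis by simp
qed

text \<open>
  In the splitting of the Wiener law by \<open>z\<close> and \<open>w\<close>, adding \<open>b h / \<surd>v\<close> to the path means
  adding \<open>b\<close> to \<open>z\<close> and leaving \<open>w\<close> alone. For fixed \<open>w\<close> the claim is therefore the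
  one-dimensional inequality, with the term of mean \<open>2b\<close> bounded by its total mass 1.
\<close>
lemma wiener_shift_prob_le:
  fixes a :: "point \<Rightarrow> real"
  assumes M: "wiener_law d M" and S: "finite S" "S \<subseteq> unit_cube d"
  defines "v \<equiv> wiener_inner d S a a"
    and "h \<equiv> \<lambda>t. \<Sum>s\<in>S. a s * wiener_cov d s t"
  assumes v: "0 < v" and s: "0 < s" and E: "E \<in> sets (path_space d)"
  shows "measure M {w \<in> space M. (\<lambda>t\<in>unit_cube d. w t + b * h t / sqrt v) \<in> E}
      \<le> s / 2 * measure M E + exp (b\<^sup>2) / (2 * s)"
proof -
  interpret M: prob_space M using M by (simp add: wiener_law_def)
  interpret Z: real_distribution std_normal_distribution by (rule real_dist_normal_dist)
  interpret ZM: pair_prob_space std_normal_distribution M ..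
  have sM: "sets M = sets (path_space d)" using M by (simp add: wiener_law_def)
  have spM: "space M = unit_cube d \<rightarrow>\<^sub>E UNIV"
    using sets_eq_imp_space_eq[OF sM] by (simp add: path_space_def space_PiM)
  have coord [measurable]: "(\<lambda>w. w t) \<in> borel_measurable M" if "t \<in> unit_cube d" for t
    using measurable_component_singleton[OF that, of "\<lambda>_. borel"] measurable_cong_sets[OF sM refl] 
    by (auto simp: path_space_def)
  define X where "X = (\<lambda>w::path. \<Sum>s\<in>S. a s * w s)"
  define \<Phi> where "\<Phi> = (\<lambda>(z, w). \<lambda>t\<in>unit_cube d. w t - h t / v * X w + h t / sqrt v * z)"
  have split: "\<Phi> \<in> std_normal_distribution \<Otimes>\<^sub>M M \<rightarrow>\<^sub>M path_space d"
      "distr (std_normal_distribution \<Otimes>\<^sub>M M) (path_space d) \<Phi> = M"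
    unfolding \<Phi>_def X_def h_def v_def by (rule wiener_law_split[OF M S v[unfolded v_def]])+
  note [measurable] = split(1) E
  have EM [measurable]: "E \<in> sets M" using E sM by simp
  define \<tau> where "\<tau> = (\<lambda>w::path. \<lambda>t\<in>unit_cube d. w t + b * h t / sqrt v)"
  have \<tau>M: "\<tau> \<in> M \<rightarrow>\<^sub>M path_space d"
    unfolding \<tau>_def path_space_def by (rule measurable_restrict) measurable
  then have [measurable]: "\<tau> \<in> path_space d \<rightarrow>\<^sub>M path_space d"
    using measurable_cong_sets[OF sM refl] by auto
  have \<tau>\<Phi>: "\<tau> (\<Phi> (z, w)) = \<Phi> (b + 1 * z, w)" for z w
    by (auto simp: \<tau>_def \<Phi>_def fun_eq_iff restrict_def algebra_simps add_divide_distrib)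
  have law: "(\<integral>\<^sup>+w. f w \<partial>M) = (\<integral>\<^sup>+w. \<integral>\<^sup>+z. f (\<Phi> (z, w)) \<partial>std_normal_distribution \<partial>M)"
    if [measurable]: "f \<in> borel_measurable (path_space d)" for f
  proof -
    have "(\<integral>\<^sup>+w. f w \<partial>M) = (\<integral>\<^sup>+x. f (\<Phi> x) \<partial>(std_normal_distribution \<Otimes>\<^sub>M M))"
      by (subst split(2)[symmetric]) (simp add: nn_integral_distr)
    also have "\<dots> = (\<integral>\<^sup>+w. \<integral>\<^sup>+z. f (\<Phi> (z, w)) \<partial>std_normal_distribution \<partial>M)"
      by (subst ZM.nn_integral_snd[symmetric]) auto
    finally show ?thesis .
  qed
  \<comment> \<open>Sections of the event at fixed \<open>w\<close>, where the one-dimensional inequality applies.\<close>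
  have sect [measurable]: "(\<lambda>z. indicator E (\<Phi> (z, w)) :: ennreal) \<in> borel_measurable borel" if "w \<in> space M" for w
  proof -
    have "(\<lambda>z. \<Phi> (z, w)) \<in> std_normal_distribution \<rightarrow>\<^sub>M path_space d"
      by (rule measurable_compose[OF measurable_Pair2'[OF that] split(1)])
    then show ?thesis by measurable
  qed
  have inner: "(\<integral>\<^sup>+z. indicator E (\<Phi> (b + 1 * z, w)) \<partial>std_normal_distribution)
      \<le> ennreal (s / 2) * (\<integral>\<^sup>+z. indicator E (\<Phi> (z, w)) \<partial>std_normal_distribution) + ennreal (exp (b\<^sup>2) / (2 * s))"
    if w: "w \<in> space M" for w
  proof -
    note [measurable] = sect[OF w]
    have "(\<integral>\<^sup>+z. indicator E (\<Phi> (b + 1 * z, w)) \<partial>std_normal_distribution)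
        = (\<integral>\<^sup>+z. ennreal (normal_density b 1 (b + 1 * z)) * indicator E (\<Phi> (b + 1 * z, w)) \<partial>lborel)"
      by (subst nn_integral_density) (auto simp: normal_density_def)
    also have "\<dots> = (\<integral>\<^sup>+z. ennreal (normal_density b 1 z) * indicator E (\<Phi> (z, w)) \<partial>lborel)"
      by (subst nn_integral_real_affine[where c = 1 and t = b]) auto
    also have "\<dots> \<le> (\<integral>\<^sup>+z. ennreal (s / 2) * (ennreal (std_normal_density z) * indicator E (\<Phi> (z, w)))
         + ennreal (exp (b\<^sup>2) / (2 * s)) * ennreal (normal_density (2 * b) 1 z) \<partial>lborel)"
    proof (rule nn_integral_mono)
      fix z
      show "ennreal (normal_density b 1 z) * indicator E (\<Phi> (z, w))
        \<le> ennreal (s / 2) * (ennreal (std_normal_density z) * indicator E (\<Phi> (z, w)))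
         + ennreal (exp (b\<^sup>2) / (2 * s)) * ennreal (normal_density (2 * b) 1 z)"
        using normal_density_shift_le[OF s, of b z] s
        by (auto simp: indicator_def ennreal_mult'[symmetric] ennreal_plus[symmetric] intro!: ennreal_leI
              simp del: ennreal_plus)
    qed
    also have "\<dots> = ennreal (s / 2) * (\<integral>\<^sup>+z. ennreal (std_normal_density z) * indicator E (\<Phi> (z, w)) \<partial>lborel)
         + ennreal (exp (b\<^sup>2) / (2 * s)) * (\<integral>\<^sup>+z. ennreal (normal_density (2 * b) 1 z) \<partial>lborel)"
      by (simp add: nn_integral_add nn_integral_cmult)
    also have "(\<integral>\<^sup>+z. ennreal (normal_density (2 * b) 1 z) \<partial>lborel) = 1"
      by (subst nn_integral_eq_integral) auto
    also have "(\<integral>\<^sup>+z. ennreal (std_normal_density z) * indicator E (\<Phi> (z, w)) \<partial>lborel)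
        = (\<integral>\<^sup>+z. indicator E (\<Phi> (z, w)) \<partial>std_normal_distribution)"
      by (subst nn_integral_density) auto
    finally show ?thesis by simp
  qed
  have "{w \<in> space M. \<tau> w \<in> E} \<in> sets M"
    using measurable_sets[OF \<tau>M E] by (simp add: vimage_def Int_def conj_commute)
  then have "emeasure M {w \<in> space M. \<tau> w \<in> E} = (\<integral>\<^sup>+w. indicator {w \<in> space M. \<tau> w \<in> E} w \<partial>M)"
    by (rule nn_integral_indicator[symmetric])
  also have "\<dots> = (\<integral>\<^sup>+w. indicator E (\<tau> w) \<partial>M)"
    by (intro nn_integral_cong) (simp add: indicator_def)
  also have "\<dots> = (\<integral>\<^sup>+w. \<integral>\<^sup>+z. indicator E (\<Phi> (b + 1 * z, w)) \<partial>std_normal_distribution \<partial>M)"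
    by (subst law) (auto simp: \<tau>\<Phi>)
  also have "\<dots> \<le> (\<integral>\<^sup>+w. ennreal (s / 2) * (\<integral>\<^sup>+z. indicator E (\<Phi> (z, w)) \<partial>std_normal_distribution)
        + ennreal (exp (b\<^sup>2) / (2 * s)) \<partial>M)"
    by (intro nn_integral_mono inner)
  also have "\<dots> = ennreal (s / 2) * (\<integral>\<^sup>+w. indicator E w \<partial>M) + ennreal (exp (b\<^sup>2) / (2 * s))"
    by (subst law, measurable) (simp add: nn_integral_add nn_integral_cmult M.emeasure_space_1)
  also have "(\<integral>\<^sup>+w. indicator E w \<partial>M) = ennreal (measure M E)"
    by (simp add: M.emeasure_eq_measure)
  finally have "ennreal (measure M {w \<in> space M. \<tau> w \<in> E}) \<le> ennreal (s / 2 * measure M E + exp (b\<^sup>2) / (2 * s))"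
    using s by (simp add: M.emeasure_eq_measure ennreal_mult'[symmetric] ennreal_plus[symmetric] del: ennreal_plus)
  then show ?thesis
    using s by (subst (asm) ennreal_le_iff) (auto simp: \<tau>_def intro!: add_nonneg_nonneg mult_nonneg_nonneg)
qed


section \<open>Disjoint stripes\<close>

text \<open>
  The formula includes \<open>p = \<infinity>\<close>: there \<open>real_of_ereal p\<close> is \<open>0\<close>, and so is its reciprocal, so
  the power of the positive measure is \<open>1\<close>.
\<close>
lemma Lp_norm_constant_on:
  assumes D: "D \<in> sets (cube_measure d)" and m: "0 < measure (cube_measure d) D"
    and A: "0 < A" and p: "0 < p"
    and g: "\<And>u. u \<in> unit_cube d \<Longrightarrow> \<bar>g u\<bar> = A * indicator D u"
  shows "Lp_norm d p g = A * measure (cube_measure d) D powr (1 / real_of_ereal p)"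
    and "esssup (cube_measure d) (\<lambda>u. ereal \<bar>g u\<bar>) = ereal A"
proof -
  interpret prob_space "cube_measure d" by (rule prob_space_cube)
  note [measurable] = D
  have mg: "(\<lambda>u. \<bar>g u\<bar>) \<in> borel_measurable (cube_measure d)"
    using g by (subst measurable_cong[of _ _ "\<lambda>u. A * indicator D u"]) (auto simp: space_cube)
  have meas: "(\<lambda>u. ereal \<bar>g u\<bar>) \<in> borel_measurable (cube_measure d)"
    using mg by (rule borel_measurable_ereal)
  have "esssup (cube_measure d) (\<lambda>u. ereal \<bar>g u\<bar>) \<le> ereal A"
    using A g by (intro esssup_I[OF meas] AE_I2) (auto simp: space_cube indicator_def)
  moreover have "\<not> esssup (cube_measure d) (\<lambda>u. ereal \<bar>g u\<bar>) < ereal A"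
  proof
    assume less: "esssup (cube_measure d) (\<lambda>u. ereal \<bar>g u\<bar>) < ereal A"
    have "AE u in cube_measure d. ereal \<bar>g u\<bar> < ereal A"
      by (rule eventually_mono[OF esssup_AE]) (erule le_less_trans[OF _ less])
    then have "AE u in cube_measure d. u \<notin> D"
      using g by (auto simp: space_cube indicator_def)
    then have "D \<in> null_sets (cube_measure d)" using AE_iff_null_sets[OF D] by simp
    then have "measure (cube_measure d) D = 0" by (simp add: measure_def null_setsD1)
    with m show False by simp
  qed
  ultimately show esup: "esssup (cube_measure d) (\<lambda>u. ereal \<bar>g u\<bar>) = ereal A" by (simp add: not_less)
  show "Lp_norm d p g = A * measure (cube_measure d) D powr (1 / real_of_ereal p)"
  proof (cases "p = \<infinity>")
    case True
    then show ?thesis using m by (simp add: Lp_norm_def esup)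
  next
    case False
    with p obtain r where r: "p = ereal r" "0 < r" by (cases p) auto
    have "(LINT u|cube_measure d. \<bar>g u\<bar> powr r) = (LINT u|cube_measure d. A powr r * indicator D u)"
      using g r by (intro Bochner_Integration.integral_cong) (auto simp: space_cube indicator_def)
    also have "\<dots> = A powr r * measure (cube_measure d) D"
      using D by (simp add: sets.Int_space_eq2)
    finally show ?thesis
      using r A by (simp add: Lp_norm_def powr_mult powr_powr)
  qed
qed

lemma Lp_dist_self: "0 < p \<Longrightarrow> Lp_dist d p g g = 0"
proof -
  interpret prob_space "cube_measure d" by (rule prob_space_cube)
  show ?thesis
    by (simp add: Lp_dist_def Lp_norm_def esssup_const emeasure_space_1 zero_ereal_def[symmetric])
qed

text \<open>
  The box below this point is the part of the cube with first coordinate at most \<open>x\<close>.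
\<close>
definition corner :: "nat \<Rightarrow> real \<Rightarrow> point" where
  "corner d x = (\<lambda>j\<in>{..<d}. if j = 0 then x else 1)"

lemma corner_in_cube: "0 \<le> x \<Longrightarrow> x \<le> 1 \<Longrightarrow> corner d x \<in> unit_cube d"
  by (auto simp: corner_def unit_cube_def)

lemma corner_eq_iff: "1 \<le> d \<Longrightarrow> corner d x = corner d y \<longleftrightarrow> x = y"
  by (auto simp: corner_def fun_eq_iff restrict_def)

lemma wiener_cov_corner:
  assumes "1 \<le> d" shows "wiener_cov d (corner d x) (corner d y) = min x y"
  using assms unfolding wiener_cov_def
  by (subst prod.remove[of _ 0]) (auto simp: corner_def)

lemma lower_box_corner_mono: "x \<le> y \<Longrightarrow> lower_box d (corner d x) \<subseteq> lower_box d (corner d y)"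
  by (auto simp: lower_box_def corner_def split: if_splits)

text \<open>
  Writing a slab as a difference of two boxes makes its drift a difference of two covariances, that
  is, the covariance of the Wiener process with its increment over the slab. The lower end is formed
  with the real difference \<open>real i - 1\<close>.
\<close>
definition slab :: "nat \<Rightarrow> nat \<Rightarrow> nat \<Rightarrow> point set" where
  "slab d N i = lower_box d (corner d (real i / real N)) - lower_box d (corner d ((real i - 1) / real N))"

definition stripe :: "nat \<Rightarrow> nat \<Rightarrow> real \<Rightarrow> nat \<Rightarrow> signal" where
  "stripe d N A i = (\<lambda>u. A * indicator (slab d N i) u)"

context
  fixes d N :: nat and A :: real
  assumes d: "1 \<le> d" and N: "2 \<le> N" and A: "0 < A"
begin

lemma stripe_corners:
  assumes "i \<in> {1..N}"
  shows "corner d (real i / real N) \<in> unit_cube d" "corner d ((real i - 1) / real N) \<in> unit_cube d"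
  using assms N by (auto intro!: corner_in_cube simp: field_simps)

lemma slab_sets: "i \<in> {1..N} \<Longrightarrow> slab d N i \<in> sets (cube_measure d)"
  unfolding slab_def using sets_lower_box stripe_corners by (intro sets.Diff) auto

lemma measure_lower_box_Int_slab:
  assumes i: "i \<in> {1..N}" and t: "t \<in> unit_cube d"
  shows "measure (cube_measure d) (lower_box d t \<inter> slab d N i)
    = wiener_cov d (corner d (real i / real N)) t - wiener_cov d (corner d ((real i - 1) / real N)) t"
proof -
  interpret prob_space "cube_measure d" by (rule prob_space_cube)
  let ?b = "lower_box d (corner d (real i / real N))" and ?a = "lower_box d (corner d ((real i - 1) / real N))"
  have "lower_box d t \<inter> slab d N i = (?b \<inter> lower_box d t) - (?a \<inter> lower_box d t)"
    by (auto simp: slab_def)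
  moreover have "?a \<inter> lower_box d t \<subseteq> ?b \<inter> lower_box d t"
    using lower_box_corner_mono[of "(real i - 1) / real N" "real i / real N" d] N by (auto simp: divide_right_mono)
  ultimately show ?thesis
    using i t stripe_corners[OF i] by (simp add: finite_measure_Diff sets_lower_box_Int measure_lower_box_Int)
qed

lemma measure_slab:
  assumes i: "i \<in> {1..N}" shows "measure (cube_measure d) (slab d N i) = 1 / real N"
proof -
  have le: "(real i - 1) / real N \<le> real i / real N" by (simp add: divide_right_mono)
  have "slab d N i = lower_box d (corner d (real i / real N)) \<inter> slab d N i" by (auto simp: slab_def)
  then have "measure (cube_measure d) (slab d N i) = min (real i / real N) (real i / real N) - min ((real i - 1) / real N) (real i / real N)"
    using measure_lower_box_Int_slab[OF i stripe_corners(1)[OF i]] d by (simp add: wiener_cov_corner)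
  then show ?thesis using le N by (simp add: diff_divide_distrib)
qed

lemma slab_disjoint:
  assumes "i \<in> {1..N}" "j \<in> {1..N}" "i \<noteq> j" shows "slab d N i \<inter> slab d N j = {}"
proof -
  have "slab d N i \<inter> slab d N j = {}" if "i < j" for i j
  proof -
    have "real i / real N \<le> (real j - 1) / real N" using that by (intro divide_right_mono) auto
    from lower_box_corner_mono[OF this, of d] show ?thesis by (auto simp: slab_def)
  qed
  from this[of i j] this[of j i] assms(3) show ?thesis by (cases i j rule: linorder_cases) auto
qed

lemma measure_two_slabs:
  assumes "i \<in> {1..N}" "j \<in> {1..N}" "i \<noteq> j"
  shows "measure (cube_measure d) (slab d N i \<union> slab d N j) = 2 / real N"
proof -
  interpret prob_space "cube_measure d" by (rule prob_space_cube)
  show ?thesis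
    using assms slab_disjoint[OF assms] slab_sets by (subst finite_measure_Union) (auto simp: measure_slab)
qed

lemma stripe_Linf: "i \<in> {1..N} \<Longrightarrow> stripe d N A i \<in> Linf_space d"
  using slab_sets[of i] Lp_norm_constant_on(2)[of "slab d N i" d A 1 "stripe d N A i"] A N
  by (auto simp: Linf_space_def stripe_def measure_slab abs_mult)

lemma Lp_norm_stripe:
  "i \<in> {1..N} \<Longrightarrow> 0 < p \<Longrightarrow> Lp_norm d p (stripe d N A i) = A * (1 / real N) powr (1 / real_of_ereal p)"
  using slab_sets[of i] Lp_norm_constant_on(1)[of "slab d N i" d A p "stripe d N A i"] A N
  by (simp add: stripe_def measure_slab abs_mult)

lemma abs_stripe_diff:
  assumes "i \<in> {1..N}" "j \<in> {1..N}" "i \<noteq> j"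
  shows "\<bar>stripe d N A i u - stripe d N A j u\<bar> = A * indicator (slab d N i \<union> slab d N j) u"
  using slab_disjoint[OF assms] A by (auto simp: stripe_def indicator_def)

lemma Lp_dist_stripe:
  assumes "i \<in> {1..N}" "j \<in> {1..N}" "i \<noteq> j" "0 < p"
  shows "Lp_dist d p (stripe d N A i) (stripe d N A j) = A * (2 / real N) powr (1 / real_of_ereal p)"
  unfolding Lp_dist_def measure_two_slabs[OF assms(1-3), symmetric]
  using assms slab_sets abs_stripe_diff[OF assms(1-3)] measure_two_slabs[OF assms(1-3)] A N
  by (intro Lp_norm_constant_on(1)) auto

lemma Lp_dist_stripe_pos:
  assumes "i \<in> {1..N}" "j \<in> {1..N}" "i \<noteq> j" "0 < p"
  shows "0 < Lp_dist d p (stripe d N A i) (stripe d N A j)"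
  using A N by (simp add: Lp_dist_stripe[OF assms])

lemma stripe_inj: "inj_on (stripe d N A) {1..N}"
proof (rule inj_onI, rule ccontr)
  fix i j assume "i \<in> {1..N}" "j \<in> {1..N}" "stripe d N A i = stripe d N A j" "i \<noteq> j"
  with Lp_dist_stripe_pos[of i j 1] Lp_dist_self[of 1 d "stripe d N A j"] show False by simp
qed

lemma distinct_family_stripe: "distinct_family d N (stripe d N A)"
  unfolding distinct_family_def
proof (intro ballI impI notI)
  fix i j assume ij: "i \<in> {1..N}" "j \<in> {1..N}" "i \<noteq> j"
    and ae: "AE u in cube_measure d. stripe d N A i u = stripe d N A j u"
  interpret prob_space "cube_measure d" by (rule prob_space_cube)
  from ae have "AE u in cube_measure d. u \<notin> slab d N i"
    by eventually_elim (use slab_disjoint[OF ij] A in \<open>auto simp: stripe_def indicator_def split: if_splits\<close>)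
  then have "slab d N i \<in> null_sets (cube_measure d)"
    using AE_iff_null_sets[OF slab_sets[OF ij(1)]] by simp
  then have "measure (cube_measure d) (slab d N i) = 0" by (simp add: measure_def null_setsD1)
  with measure_slab[OF ij(1)] N show False by simp
qed

lemma i_star_stripe:
  assumes k: "k \<in> {1..N}" and p: "0 < p"
  shows "i_star d N (stripe d N A) (stripe d N A k) p = k"
proof -
  let ?f = "\<lambda>i. Lp_dist d p (stripe d N A k) (stripe d N A i)"
  have "?f k = 0" by (rule Lp_dist_self[OF p])
  then have "is_arg_min ?f (\<lambda>i. i \<in> {1..N}) i \<longleftrightarrow> i = k" for i
    using Lp_dist_stripe_pos[OF k _ _ p] k unfolding is_arg_min_def
    by (metis less_asym less_irrefl)
  then show ?thesis by (simp add: i_star_def arg_min_on_def arg_min_def)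
qed

lemma Max_const_image:
  assumes "k \<in> {1..N}" "\<And>i. i \<in> {1..N} - {k} \<Longrightarrow> f i = (c :: real)"
  shows "Max (f ` ({1..N} - {k})) = c"
proof -
  have "card ({1..N} - {k}) \<noteq> 0" using assms N by simp
  then have "{1..N} - {k} \<noteq> {}" by (metis card.empty)
  then have "f ` ({1..N} - {k}) = {c}" using assms(2) by (auto simp: image_iff) 
  then show ?thesis by simp
qed

lemma Q3_stripe:
  assumes k: "k \<in> {1..N}" and p: "0 < p"
  shows "Q3 d N (stripe d N A) (stripe d N A k) p = (2 / real N) powr (1 / real_of_ereal p - 1 / 2)"
  unfolding Q3_def Let_def i_star_stripe[OF k p]
  using A N k p by (intro Max_const_image) (auto simp: Lp_dist_stripe powr_diff)

text \<open>
  The exponent is \<open>(1 / (2q - 2) - 1 / q) (q - 1) = 1 / q - 1 / 2\<close>; at \<open>q = 2\<close> it is \<open>0\<close>, in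
  agreement with the separate definition of \<open>Q1\<close> up to \<open>2\<close>.
\<close>
lemma Q1_stripe:
  assumes k: "k \<in> {1..N}" and q: "2 \<le> q"
  shows "Q1 d N (stripe d N A) (stripe d N A k) q = (2 / real N) powr (1 / q - 1 / 2)"
proof (cases "q = 2")
  case True
  then show ?thesis using N by (simp add: Q1_def)
next
  case False
  with q have q: "2 < q" by simp
  have e: "(1 / (2 * q - 2) - 1 / q) * (q - 1) = 1 / q - 1 / 2"
    using q by (simp add: field_simps)
  have i: "i_star d N (stripe d N A) (stripe d N A k) (ereal q) = k"
    using q by (intro i_star_stripe[OF k]) simp
  have "(A * (2 / real N) powr (1 / (2 * q - 2)) / (A * (2 / real N) powr (1 / q))) powr (q - 1)
     = (2 / real N) powr (1 / q - 1 / 2)"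
    using A N by (simp add: powr_diff[symmetric] powr_powr e)
  then show ?thesis
    unfolding Q1_def Let_def i
    using q k by (subst Max_const_image[OF k]) (auto simp: Lp_dist_stripe)
qed

text \<open>
  Two stripes differ by \<open>A\<close> or by \<open>0\<close>, so for \<open>\<gamma> \<le> A\<close> the truncated difference is \<open>\<gamma>\<close> on the
  two slabs and \<open>0\<close> elsewhere, and \<open>\<gamma>\<close> cancels in the quotient.
\<close>
lemma Q4_stripe:
  assumes k: "k \<in> {1..N}" and \<gamma>: "admissible_level d N (stripe d N A) (stripe d N A k) \<gamma>"
  shows "Q4 d N (stripe d N A) (stripe d N A k) \<gamma> = (2 / real N) powr (- (1 / 2))"
proof -
  have i: "i_star d N (stripe d N A) (stripe d N A k) \<infinity> = k"
    by (intro i_star_stripe[OF k]) simp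
  have dist: "Lp_dist d \<infinity> (stripe d N A k) (stripe d N A i) = A" if "i \<in> {1..N} - {k}" for i
    using that k N by (subst Lp_dist_stripe) auto
  have ne: "\<exists>i. i \<in> {1..N} - {k}"
    using N k by (cases "k = 1") (auto intro: exI[of _ 1] exI[of _ 2])
  have g: "0 < \<gamma>" "\<gamma> \<le> A"
    using \<gamma> dist ne by (auto simp: admissible_level_def i Let_def)
  have norm: "Lp_norm d p (S_diff d (stripe d N A) k i \<gamma>) = \<gamma> * (2 / real N) powr (1 / real_of_ereal p)"
    if i: "i \<in> {1..N} - {k}" and p: "0 < p" for i p
  proof -
    have ki: "k \<in> {1..N}" "i \<in> {1..N}" "k \<noteq> i" using k i by auto
    show ?thesis
      unfolding measure_two_slabs[OF ki, symmetric]
      using g N p ki slab_sets measure_two_slabs[OF ki] dist[OF i]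
      by (intro Lp_norm_constant_on(1)) (auto simp: S_diff_def abs_stripe_diff[OF ki] indicator_def)
  qed
  have "Lp_norm d 2 (S_diff d (stripe d N A) k i \<gamma>) / Lp_norm d 1 (S_diff d (stripe d N A) k i \<gamma>)
      = (2 / real N) powr (- (1 / 2))" if "i \<in> {1..N} - {k}" for i
  proof -
    have "Lp_norm d 2 (S_diff d (stripe d N A) k i \<gamma>) / Lp_norm d 1 (S_diff d (stripe d N A) k i \<gamma>)
      = (2 / real N) powr (1 / 2) / (2 / real N) powr 1"
      using g norm[OF that, of 2] norm[OF that, of 1] by simp
    also have "\<dots> = (2 / real N) powr (1 / 2 - 1)" by (rule powr_diff[symmetric])
    finally show ?thesis by simp
  qed
  then show ?thesis
    unfolding Q4_def Let_def i by (rule Max_const_image[OF k])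
qed

end


section \<open>The lower bound for selection rules\<close>

lemma drift_stripe:
  assumes d: "1 \<le> d" and N: "2 \<le> N" and i: "i \<in> {1..N}" and t: "t \<in> unit_cube d"
  shows "drift d (stripe d N A i) t
    = A * (wiener_cov d (corner d (real i / real N)) t - wiener_cov d (corner d ((real i - 1) / real N)) t)"
proof -
  have "drift d (stripe d N A i) t = (LINT u|cube_measure d. A * indicator (lower_box d t \<inter> slab d N i) u)"
    unfolding drift_def set_lebesgue_integral_def lower_box_def[symmetric] stripe_def
    by (intro Bochner_Integration.integral_cong refl) (auto simp: indicator_def)
  also have "\<dots> = A * measure (cube_measure d) (lower_box d t \<inter> slab d N i)"
    using sets_lower_box[OF t] slab_sets[OF d N zero_less_one i] by (simp add: sets.Int_space_eq2 sets.Int)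
  finally show ?thesis
    by (simp add: measure_lower_box_Int_slab[OF d N zero_less_one i t])
qed

lemma observation_measurable:
  assumes "sets M = sets (path_space d)"
  shows "observation d \<epsilon> f \<in> M \<rightarrow>\<^sub>M path_space d"
proof -
  have [measurable]: "(\<lambda>w. w t) \<in> borel_measurable M" if "t \<in> unit_cube d" for t
    using measurable_component_singleton[OF that, of "\<lambda>_. borel"] measurable_cong_sets[OF assms refl]
    by (auto simp: path_space_def)
  show ?thesis
    unfolding observation_def path_space_def by (rule measurable_restrict) measurable
qed

text \<open>
  The drift of a stripe is \<open>A\<close> times the covariance function of the increment of the Wiener
  process over its slab. This increment has variance \<open>1 / N\<close>, so relative to the noise level the
  stripe is a shift by \<open>b = A / (\<epsilon> \<surd>N)\<close> standard deviations of the increment.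
\<close>
lemma measure_observation_law_stripe_le:
  assumes M: "wiener_law d M" and d: "1 \<le> d" and N: "2 \<le> N" and A: "0 < A" and \<epsilon>: "0 < \<epsilon>"
    and i: "i \<in> {1..N}" and s: "0 < s" and E: "E \<in> sets (path_space d)"
  shows "measure (observation_law d \<epsilon> M (stripe d N A i)) E
    \<le> s / 2 * measure (observation_law d \<epsilon> M (\<lambda>_. 0)) E + exp ((A / (\<epsilon> * sqrt N))\<^sup>2) / (2 * s)"
proof -
  have sM: "sets M = sets (path_space d)" using M by (simp add: wiener_law_def)
  define x y where "x = real i / real N" and "y = (real i - 1) / real N"
  have xy: "y < x" "x - y = 1 / real N" using N by (auto simp: x_def y_def field_simps)
  define S where "S = {corner d x, corner d y}"
  define a where "a = (\<lambda>s. if s = corner d x then 1 else - 1 :: real)"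
  have ne: "corner d x \<noteq> corner d y" using xy by (simp add: corner_eq_iff[OF d])
  have S: "finite S" "S \<subseteq> unit_cube d"
    using stripe_corners[OF d N A i] by (auto simp: S_def x_def y_def)
  have h: "(\<Sum>s\<in>S. a s * wiener_cov d s t) = wiener_cov d (corner d x) t - wiener_cov d (corner d y) t" for t
    using ne by (simp add: S_def a_def)
  have v: "wiener_inner d S a a = 1 / real N"
    using ne xy by (simp add: wiener_inner_def S_def a_def wiener_cov_corner[OF d])
  define \<sigma> where "\<sigma> = (\<lambda>w::path. \<lambda>t\<in>unit_cube d. \<epsilon> * w t)"
  have obs0: "observation d \<epsilon> (\<lambda>_. 0) = \<sigma>"
    by (simp add: observation_def \<sigma>_def drift_def fun_eq_iff)
  define E' where "E' = \<sigma> -` E \<inter> space M"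
  have E': "E' \<in> sets (path_space d)"
    unfolding E'_def obs0[symmetric] using measurable_sets[OF observation_measurable[OF sM] E] sM by simp
  have sp: "space M = unit_cube d \<rightarrow>\<^sub>E UNIV"
    using sets_eq_imp_space_eq[OF sM] by (simp add: path_space_def space_PiM)
  have shift: "observation d \<epsilon> (stripe d N A i) w
      = \<sigma> (\<lambda>t\<in>unit_cube d. w t + A / (\<epsilon> * sqrt N) * (\<Sum>s\<in>S. a s * wiener_cov d s t) / sqrt (wiener_inner d S a a))" for w
  proof -
    have "A / (\<epsilon> * sqrt N) * k / sqrt (1 / real N) = A * k / \<epsilon>" for k
      using N \<epsilon> by (simp add: real_sqrt_divide field_simps)
    then show ?thesis
      unfolding h v using \<epsilon> by (simp only:, auto simp: observation_def \<sigma>_def drift_stripe[OF d N i] x_def y_def fun_eq_iff restrict_def field_simps)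
  qed
  have "measure (observation_law d \<epsilon> M (stripe d N A i)) E
      = measure M (observation d \<epsilon> (stripe d N A i) -` E \<inter> space M)"
    unfolding observation_law_def by (rule measure_distr[OF observation_measurable[OF sM] E])
  also have "observation d \<epsilon> (stripe d N A i) -` E \<inter> space M =
     {w \<in> space M. (\<lambda>t\<in>unit_cube d. w t + A / (\<epsilon> * sqrt N) * (\<Sum>s\<in>S. a s * wiener_cov d s t) / sqrt (wiener_inner d S a a)) \<in> E'}"
    unfolding E'_def shift by (auto simp: sp)
  also have "measure M \<dots> \<le> s / 2 * measure M E' + exp ((A / (\<epsilon> * sqrt N))\<^sup>2) / (2 * s)"
    using N v by (intro wiener_shift_prob_le[OF M S _ s E']) simp
  also have "measure M E' = measure (observation_law d \<epsilon> M (\<lambda>_. 0)) E"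
    unfolding observation_law_def E'_def obs0[symmetric]
    by (rule measure_distr[OF observation_measurable[OF sM] E, symmetric])
  finally show ?thesis .
qed

lemma prob_space_observation_law: "wiener_law d M \<Longrightarrow> prob_space (observation_law d \<epsilon> M f)"
  unfolding observation_law_def
  by (intro prob_space.prob_space_distr observation_measurable) (auto simp: wiener_law_def)

text \<open>
  Under pure noise the probabilities of disjoint events add up to at most one, so the bound is
  \<open>s / 2 + N C / (2s)\<close> with \<open>C = exp (b\<^sup>2)\<close> and \<open>b = A / (\<epsilon> \<surd>N)\<close>. Its minimum over \<open>s\<close> is attained at \<open>s = \<surd>(N C)\<close>.
\<close>
lemma sum_detection_prob_le:
  assumes M: "wiener_law d M" and d: "1 \<le> d" and N: "2 \<le> N" and A: "0 < A" and \<epsilon>: "0 < \<epsilon>"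
    and E: "\<And>i. i \<in> {1..N} \<Longrightarrow> E i \<in> sets (path_space d)" and disj: "disjoint_family_on E {1..N}"
  shows "(\<Sum>i\<in>{1..N}. measure (observation_law d \<epsilon> M (stripe d N A i)) (E i))
    \<le> sqrt N * exp ((A / (\<epsilon> * sqrt N))\<^sup>2 / 2)"
proof -
  interpret P0: prob_space "observation_law d \<epsilon> M (\<lambda>_. 0)" by (rule prob_space_observation_law[OF M])
  define C where "C = exp ((A / (\<epsilon> * sqrt N))\<^sup>2)"
  define s where "s = sqrt N * exp ((A / (\<epsilon> * sqrt N))\<^sup>2 / 2)"
  have s: "0 < s" using N by (simp add: s_def)
  have s2: "real N * C = s\<^sup>2"
    by (simp add: s_def C_def power_mult_distrib exp_double[symmetric])
  have E0: "E ` {1..N} \<subseteq> P0.events" using E by (auto simp: observation_law_def)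
  have "(\<Sum>i\<in>{1..N}. measure (observation_law d \<epsilon> M (stripe d N A i)) (E i))
      \<le> (\<Sum>i\<in>{1..N}. s / 2 * P0.prob (E i) + C / (2 * s))"
    unfolding C_def using measure_observation_law_stripe_le[OF M d N A \<epsilon> _ s] E by (intro sum_mono) auto
  also have "\<dots> = s / 2 * P0.prob (\<Union>i\<in>{1..N}. E i) + s\<^sup>2 / (2 * s)"
    using P0.finite_measure_finite_Union[OF _ E0 disj] s2
    by (simp add: sum.distrib sum_distrib_left)
  also have "\<dots> \<le> s / 2 * 1 + s\<^sup>2 / (2 * s)"
    using s by (intro add_mono mult_left_mono) auto
  also have "\<dots> = s" using s by (simp add: power2_eq_square)
  finally show ?thesis by (simp add: s_def)
qed

text \<open>
  All wrong selections are equally bad, as the family is equidistant.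
\<close>
lemma risk_stripe:
  assumes M: "wiener_law d M" and d: "1 \<le> d" and N: "2 \<le> N" and A: "0 < A" and p: "0 < p"
    and T: "selection_rule d (stripe d N A ` {1..N}) T" and i: "i \<in> {1..N}"
  shows "risk d \<epsilon> M p T (stripe d N A i) = A * (2 / real N) powr (1 / real_of_ereal p)
    * (1 - measure (observation_law d \<epsilon> M (stripe d N A i)) {y \<in> space (path_space d). T y = stripe d N A i})"
proof -
  let ?P = "observation_law d \<epsilon> M (stripe d N A i)" and ?E = "{y \<in> space (path_space d). T y = stripe d N A i}"
  interpret P: prob_space ?P by (rule prob_space_observation_law[OF M])
  have sp: "space ?P = space (path_space d)" "P.events = sets (path_space d)" by (auto simp: observation_law_def)
  have Tm: "T \<in> path_space d \<rightarrow>\<^sub>M count_space (stripe d N A ` {1..N})" using T by (simp add: selection_rule_def)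
  have "T -` {stripe d N A i} \<inter> space (path_space d) \<in> sets (path_space d)"
    using i by (intro measurable_sets[OF Tm]) auto
  then have E: "?E \<in> P.events" by (simp add: sp vimage_def Int_def conj_commute)
  have "risk d \<epsilon> M p T (stripe d N A i)
      = (LINT y|?P. A * (2 / real N) powr (1 / real_of_ereal p) * indicator (space ?P - ?E) y)"
    unfolding risk_def
  proof (intro Bochner_Integration.integral_cong refl)
    fix y assume "y \<in> space ?P"
    moreover from this obtain j where "j \<in> {1..N}" "T y = stripe d N A j"
      using measurable_space[OF Tm, of y] by (auto simp: sp)
    ultimately show "Lp_dist d p (T y) (stripe d N A i) = A * (2 / real N) powr (1 / real_of_ereal p) * indicator (space ?P - ?E) y"
      using Lp_dist_self[OF p] Lp_dist_stripe[OF d N A _ i _ p] inj_on_eq_iff[OF stripe_inj[OF d N A]] i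
      by (cases "j = i") (auto simp: sp)
  qed
  then show ?thesis using P.prob_compl[OF E] E by (simp add: sets.Int_space_eq2 sets.compl_sets)
qed

text \<open>
  The height is chosen so that the squared signal-to-noise ratio is \<open>ln (N - 1) / 2\<close>. Then the
  success probabilities have the sum \<open>\<surd>N (N - 1)\<^bsup>1/4\<^esup>\<close> at most, and they cannot all exceed
  \<open>3/4\<close>, since \<open>N\<^bsup>-1/4\<^esup> \<le> 4\<^bsup>-1/4\<^esup> < 3/4\<close>. In addition, the distance of two stripes is
  \<open>\<epsilon> \<surd>(ln (N - 1))\<close> times the common value of the characteristics.
\<close>
lemma Max_excess_risk_stripe_ge:
  assumes M: "wiener_law d M" and d: "1 \<le> d" and N: "3 < N" and p: "0 < p" and \<epsilon>: "0 < \<epsilon>"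
    and A: "A = \<epsilon> * sqrt (real N * ln (real N - 1) / 2)"
    and T: "selection_rule d (stripe d N A ` {1..N}) T"
  shows "1 / 4 * (2 / real N) powr (1 / real_of_ereal p - 1 / 2) * \<epsilon> * sqrt (ln (real N - 1))
    \<le> Max ((\<lambda>f. risk d \<epsilon> M p T f - Min ((\<lambda>i. Lp_dist d p f (stripe d N A i)) ` {1..N})) ` (stripe d N A ` {1..N}))"
proof -
  let ?F = "stripe d N A"
  define l where "l = ln (real N - 1)"
  have l: "0 < l" using N by (simp add: l_def)
  have N2: "2 \<le> N" using N by simp
  have A0: "0 < A" using \<epsilon> l N unfolding A l_def[symmetric] by simp
  define E where "E = (\<lambda>i. {y \<in> space (path_space d). T y = ?F i})"
  have Tm: "T \<in> path_space d \<rightarrow>\<^sub>M count_space (?F ` {1..N})" using T by (simp add: selection_rule_def)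
  have E: "E i \<in> sets (path_space d)" if "i \<in> {1..N}" for i
  proof -
    have "T -` {?F i} \<inter> space (path_space d) \<in> sets (path_space d)"
      using that by (intro measurable_sets[OF Tm]) auto
    then show ?thesis by (simp add: E_def vimage_def Int_def conj_commute)
  qed
  have disj: "disjoint_family_on E {1..N}"
    using inj_on_eq_iff[OF stripe_inj[OF d N2 A0]] by (auto simp: disjoint_family_on_def E_def)
  have snr: "(A / (\<epsilon> * sqrt N))\<^sup>2 / 2 = l / 4"
    using \<epsilon> l N unfolding A l_def[symmetric] by (simp add: power_divide power_mult_distrib)
  define P where "P = (\<lambda>i. measure (observation_law d \<epsilon> M (?F i)) (E i))"
  have "\<exists>i\<in>{1..N}. P i \<le> 3 / 4"
  proof (rule ccontr)
    assume "\<not> ?thesis"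
    then have "3 / 4 \<le> P i" if "i \<in> {1..N}" for i using that by (meson linear)
    then have "(\<Sum>i\<in>{1..N}. 3 / 4) \<le> (\<Sum>i\<in>{1..N}. P i)" by (intro sum_mono)
    also have "\<dots> \<le> sqrt N * exp (l / 4)"
      using sum_detection_prob_le[OF M d N2 A0 \<epsilon> E disj] by (simp add: P_def snr)
    finally have le: "3 / 4 * real N \<le> sqrt N * exp (l / 4)" by simp
    \<comment> \<open>Fourth powers remove both roots.\<close>
    have "(3 / 4 * real N) ^ 4 \<le> (sqrt N * exp (l / 4)) ^ 4"
      using le by (intro power_mono) auto
    also have "\<dots> = (real N)\<^sup>2 * exp l"
      using exp_of_nat_mult[of 4 "l / 4"] power_mult[of "sqrt N" 2 2] by (simp add: power_mult_distrib)
    also have "exp l = real N - 1" using N by (simp add: l_def)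
    finally have "(real N)\<^sup>2 * (81 / 256 * (real N)\<^sup>2) \<le> (real N)\<^sup>2 * (real N - 1)"
      by (simp add: power_mult_distrib power4_eq_xxxx power2_eq_square)
    then have "81 / 256 * (real N)\<^sup>2 \<le> real N - 1" using N by simp
    moreover have "4 * real N \<le> (real N)\<^sup>2" using N by (simp add: power2_eq_square)
    ultimately show False using N by simp
  qed
  then obtain i where i: "i \<in> {1..N}" and Pi: "P i \<le> 3 / 4" by blast
  have K: "A * (2 / real N) powr (1 / real_of_ereal p)
      = (2 / real N) powr (1 / real_of_ereal p - 1 / 2) * \<epsilon> * sqrt l"
  proof -
    have "A = \<epsilon> * sqrt l / sqrt (2 / real N)"
      using N unfolding A l_def[symmetric] by (simp add: real_sqrt_mult real_sqrt_divide)
    also have "sqrt (2 / real N) = (2 / real N) powr (1 / 2)" by (simp add: powr_half_sqrt)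
    finally show ?thesis by (simp add: powr_diff)
  qed
  have "1 / 4 * (2 / real N) powr (1 / real_of_ereal p - 1 / 2) * \<epsilon> * sqrt l
     = A * (2 / real N) powr (1 / real_of_ereal p) * (1 / 4)"
    by (simp add: K)
  also have "\<dots> \<le> A * (2 / real N) powr (1 / real_of_ereal p) * (1 - P i)"
    using Pi A0 by (intro mult_left_mono) auto
  also have "\<dots> = risk d \<epsilon> M p T (?F i)"
    using risk_stripe[OF M d N2 A0 p T i] by (simp add: P_def E_def)
  also have "\<dots> \<le> risk d \<epsilon> M p T (?F i) - Min ((\<lambda>j. Lp_dist d p (?F i) (?F j)) ` {1..N})"
  proof -
    have "Min ((\<lambda>j. Lp_dist d p (?F i) (?F j)) ` {1..N}) \<le> Lp_dist d p (?F i) (?F i)"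
      using i by (intro Min_le) auto
    then show ?thesis by (simp add: Lp_dist_self[OF p])
  qed
  also have "\<dots> \<le> Max ((\<lambda>f. risk d \<epsilon> M p T f - Min ((\<lambda>i. Lp_dist d p f (?F i)) ` {1..N})) ` (?F ` {1..N}))"
    using i by (intro Max_ge) auto
  finally show ?thesis by (simp add: l_def)
qed

lemma amplitude_le:
  assumes N: "3 < N" and \<epsilon>: "0 < \<epsilon>" "\<epsilon> \<le> L * (real N * ln (real N)) powr (- 1 / 2)"
  shows "\<epsilon> * sqrt (real N * ln (real N - 1) / 2) \<le> L"
proof -
  have pos: "0 < real N * ln (real N)" using N by simp
  have L: "\<epsilon> \<le> L / sqrt (real N * ln (real N))"
  proof -
    have "(real N * ln (real N)) powr (- 1 / 2) = inverse (sqrt (real N * ln (real N)))"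
      using pos powr_minus[of "real N * ln (real N)" "1 / 2"] by (simp only: powr_half_sqrt less_imp_le minus_divide_left)
    with \<epsilon>(2) show ?thesis by (simp only: divide_inverse)
  qed
  have "real N * ln (real N - 1) / 2 \<le> real N * ln (real N - 1)" using N by simp
  also have "\<dots> \<le> real N * ln (real N)" using N by (intro mult_left_mono) auto
  finally have "\<epsilon> * sqrt (real N * ln (real N - 1) / 2) \<le> \<epsilon> * sqrt (real N * ln (real N))"
    using \<epsilon> by (intro mult_left_mono) auto
  also have "\<dots> \<le> L / sqrt (real N * ln (real N)) * sqrt (real N * ln (real N))"
    using L pos by (intro mult_right_mono) auto
  also have "\<dots> = L" using N by simp
  finally show ?thesis .
qed

theorem theorem2:
  shows "\<exists>c::real. c > 0 \<and>
    (\<forall>(d::nat) (N::nat) (L::real) (p::ereal) (\<epsilon>::real).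
       d \<ge> 1 \<and> N > 3 \<and> L > 0 \<and> 2 < p \<and> 0 < \<epsilon> \<and> \<epsilon> < 1 \<and>
       \<epsilon> \<le> L * (real N * ln (real N)) powr (-1/2) \<longrightarrow>
       (\<exists>(F :: nat \<Rightarrow> signal) (K :: ereal \<Rightarrow> real).
          (\<forall>i\<in>{1..N}. F i \<in> Linf_space d) \<and>
          distinct_family d N F \<and>
          Max ((\<lambda>i. Lp_norm d p (F i)) ` {1..N}) \<le> L \<and>
          (\<forall>f\<in>F ` {1..N}.
             (\<forall>q::real. q \<ge> 2 \<longrightarrow> K (ereal q) = Q1 d N F f q \<and> K (ereal q) = Q3 d N F f (ereal q)) \<and>
             K \<infinity> = Q3 d N F f \<infinity> \<and>
             (\<forall>\<gamma>. admissible_level d N F f \<gamma> \<longrightarrow> K \<infinity> = Q4 d N F f \<gamma>)) \<and>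
          (\<forall>M T. wiener_law d M \<and> selection_rule d (F ` {1..N}) T \<longrightarrow>
             Max ((\<lambda>f. risk d \<epsilon> M p T f - Min ((\<lambda>i. Lp_dist d p f (F i)) ` {1..N})) ` (F ` {1..N}))
               \<ge> c * K p * \<epsilon> * sqrt (ln (real N - 1)))))"
proof (rule exI[of _ "1 / 4"], intro conjI allI impI)
  fix d N :: nat and L \<epsilon> :: real and p :: ereal
  assume "d \<ge> 1 \<and> N > 3 \<and> L > 0 \<and> 2 < p \<and> 0 < \<epsilon> \<and> \<epsilon> < 1 \<and>
       \<epsilon> \<le> L * (real N * ln (real N)) powr (-1/2)"
  then have d: "1 \<le> d" and N: "3 < N" and p: "2 < p" and \<epsilon>: "0 < \<epsilon>"
    and \<epsilon>L: "\<epsilon> \<le> L * (real N * ln (real N)) powr (-1/2)" by auto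
  define A where "A = \<epsilon> * sqrt (real N * ln (real N - 1) / 2)"
  have N2: "2 \<le> N" using N by simp
  have A: "0 < A" "A \<le> L" using N \<epsilon> amplitude_le[OF N \<epsilon> \<epsilon>L] by (auto simp: A_def)
  have p0: "0 < p" using p by (rule less_trans[rotated]) simp
  define K where "K = (\<lambda>p. (2 / real N) powr (1 / real_of_ereal p - 1 / 2))"
  have "Lp_norm d p (stripe d N A i) \<le> L" if "i \<in> {1..N}" for i
  proof -
    have "(1 / real N) powr (1 / real_of_ereal p) \<le> (1 / real N) powr 0"
      using N p0 by (intro powr_mono') (auto simp: real_of_ereal_pos)
    then have "Lp_norm d p (stripe d N A i) \<le> A * 1"
      unfolding Lp_norm_stripe[OF d N2 A(1) that p0] using A N by (intro mult_left_mono) auto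
    with A show ?thesis by simp
  qed
  then have norm: "Max ((\<lambda>i. Lp_norm d p (stripe d N A i)) ` {1..N}) \<le> L"
    using N by (intro Max.boundedI) auto
  have risk: "1 / 4 * K p * \<epsilon> * sqrt (ln (real N - 1))
      \<le> Max ((\<lambda>f. risk d \<epsilon> M p T f - Min ((\<lambda>i. Lp_dist d p f (stripe d N A i)) ` {1..N})) ` (stripe d N A ` {1..N}))"
    if "wiener_law d M \<and> selection_rule d (stripe d N A ` {1..N}) T" for M T
    unfolding K_def using that by (intro Max_excess_risk_stripe_ge[OF _ d N p0 \<epsilon> A_def]) auto
  have chars: "(\<forall>q::real. q \<ge> 2 \<longrightarrow> K (ereal q) = Q1 d N (stripe d N A) f q \<and> K (ereal q) = Q3 d N (stripe d N A) f (ereal q)) \<and>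
      K \<infinity> = Q3 d N (stripe d N A) f \<infinity> \<and>
      (\<forall>\<gamma>. admissible_level d N (stripe d N A) f \<gamma> \<longrightarrow> K \<infinity> = Q4 d N (stripe d N A) f \<gamma>)"
    if f: "f \<in> stripe d N A ` {1..N}" for f
    using f Q1_stripe[OF d N2 A(1)] Q3_stripe[OF d N2 A(1)] Q4_stripe[OF d N2 A(1)] by (auto simp: K_def)
  show "\<exists>(F :: nat \<Rightarrow> signal) (K :: ereal \<Rightarrow> real).
          (\<forall>i\<in>{1..N}. F i \<in> Linf_space d) \<and>
          distinct_family d N F \<and>
          Max ((\<lambda>i. Lp_norm d p (F i)) ` {1..N}) \<le> L \<and>
          (\<forall>f\<in>F ` {1..N}.
             (\<forall>q::real. q \<ge> 2 \<longrightarrow> K (ereal q) = Q1 d N F f q \<and> K (ereal q) = Q3 d N F f (ereal q)) \<and>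
             K \<infinity> = Q3 d N F f \<infinity> \<and>
             (\<forall>\<gamma>. admissible_level d N F f \<gamma> \<longrightarrow> K \<infinity> = Q4 d N F f \<gamma>)) \<and>
          (\<forall>M T. wiener_law d M \<and> selection_rule d (F ` {1..N}) T \<longrightarrow>
             Max ((\<lambda>f. risk d \<epsilon> M p T f - Min ((\<lambda>i. Lp_dist d p f (F i)) ` {1..N})) ` (F ` {1..N}))
               \<ge> 1 / 4 * K p * \<epsilon> * sqrt (ln (real N - 1)))"
    by (rule exI[of _ "stripe d N A"], rule exI[of _ K])
      (use stripe_Linf[OF d N2 A(1)] distinct_family_stripe[OF d N2 A(1)] norm chars risk in blast)
qed simp

end
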